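(* The map $\Psi\colon\mathrm{Mat}\to\mathrm{WQSym}$, given on each finite set $U$ by $\Psi(M)=\sum_\pi\mathbf M_\pi$ (sum over all $M$-generic set compositions $\pi$ of $U$), is a Hopf monoid morphism. Further, the corresponding map between Hopf algebras is a Hopf algebra morphism.
   Context: A set composition $\pi=(\pi_1,\dots,\pi_k)$ of a finite set $U$ is an ordered tuple of non-empty disjoint sets with union $U$. For $A\subseteq U$, $\pi|_A$ is obtained from $(\pi_1\cap A,\dots,\pi_k\cap A)$ by deleting empty parts. For disjoint $A,B\subseteq U$ write $A<_\pi B$ if for all $a\in A$, $b\in B$ with $a\in\pi_i$, $b\in\pi_j$ one has $i<j$. For a matroid $M$ on $U$, $\pi$ is $M$-generic if, with $f_\pi(u)=j$ for $u\in\pi_j$, there is a unique basis $B$ of $M$ maximizing $\sum_{u\in B}f_\pi(u)$. Vector spaces are over $\mathbb R$. $\mathrm{Mat}[U]$ is the vector space with basis all matroids on $U$; $\mathrm{WQSym}[U]$ is the vector space with basis $\{\mathbf M_\pi\}$, $\pi$ ranging over set compositions of $U$. For $U=[d]=\{1,\dots,d\}$, $\mathbf M_\pi$ is identified with the series $\sum_fw_{f(1)}\cdots w_{f(d)}$ in non-commuting variables $w_1,w_2,\dots$ over all $f\colon[d]\to\mathbb Z_{\ge1}$ whose level sets, listed by increasing value, are $\pi_1,\dots,\pi_k$. Hopf monoid structures (for $U=A\sqcup B$): - $\mathrm{Mat}$: $\mu_{A,B}(M\otimes N)=M\oplus N$ (direct sum); $\Delta_{A,B}(M)=M|_A\otimes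 M/A$, where $M|_A$ is the restriction to $A$ and $M/A$ is the contraction of $A$, a matroid on $B$. - $\mathrm{WQSym}$: $\mu_{A,B}(\mathbf M_\tau\otimes\mathbf M_\sigma)=\sum\mathbf M_\pi$ over set compositions $\pi$ of $A\sqcup B$ with $\pi|_A=\tau$, $\pi|_B=\sigma$; $\Delta_{A,B}(\mathbf M_\pi)=\mathbf M_{\pi|_A}\otimes\mathbf M_{\pi|_B}$ if $A<_\pi B$, and $0$ otherwise. Units and counits are the obvious ones on $U=\emptyset$, where both spaces are one-dimensional. A Hopf monoid morphism is a family of linear maps, natural in bijections of $U$, compatible with products, coproducts, units and counits. The Hopf algebra associated to such a Hopf monoid $H$ is $\bigoplus_{d\ge0}H[[d]]$, with product of $x\in H[[m]]$ and $y\in H[[n]]$ equal to $\mu_{[m],\{m+1,\dots,m+n\}}(x\otimes y')$, where $y'$ is $y$ relabelled by $i\mapsto m+i$, and coproduct $\Delta(x)=\sum_{A\sqcup B=[d]}(\mathrm{st}_A\otimes\mathrm{st}_B)\Delta_{A,B}(x)$ for $x\in H[[d]]$, where $\mathrm{st}_A,\mathrm{st}_B$ denote relabelling along the order-preserving bijections $A\to[|A|]$, $B\to[|B|]$.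
   Formalization: M-generic is taken to mean that a unique basis minimizes, not maximizes, the sum of f_π; with "maximizing" and the stated coproducts the claim fails, e.g. for the rank-one uniform matroid on {a,b,c} with A={a}. *)

theory Defs
  imports "HOL-Analysis.Finite_Function_Topology" "HOL-Library.Disjoint_Sets"
begin

section \<open>Free real vector spaces\<close>

text \<open>
  The real vector space with basis \<open>X\<close> is the subspace \<open>free_space X\<close> of the finitely supported
  functions \<open>'b \<Rightarrow>\<^sub>0 real\<close>. As every space involved is given with a basis, the tensor product of
  \<open>free_space X\<close> and \<open>free_space Y\<close> is taken to be \<open>free_space (X \<times> Y)\<close>, with
  \<open>x \<otimes> y\<close> identified with the pair \<open>(x, y)\<close> for basis elements.
\<close>

definition free_space :: "'b set \<Rightarrow> ('b \<Rightarrow>\<^sub>0 real) set"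
  where "free_space X = {x. Poly_Mapping.keys x \<subseteq> X}"

abbreviation basis_vec :: "'b \<Rightarrow> 'b \<Rightarrow>\<^sub>0 real"
  where "basis_vec b \<equiv> Poly_Mapping.single b 1"

definition lin_ext :: "('b \<Rightarrow> 'v::real_vector) \<Rightarrow> ('b \<Rightarrow>\<^sub>0 real) \<Rightarrow> 'v"
  where "lin_ext f x = (\<Sum>b\<in>Poly_Mapping.keys x. Poly_Mapping.lookup x b *\<^sub>R f b)"

definition linear_between :: "'v::real_vector set \<Rightarrow> 'w::real_vector set \<Rightarrow> ('v \<Rightarrow> 'w) \<Rightarrow> bool"
  where "linear_between V W f \<longleftrightarrow>
    f ` V \<subseteq> W \<and>
    (\<forall>x\<in>V. \<forall>y\<in>V. f (x + y) = f x + f y) \<and>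
    (\<forall>c. \<forall>x\<in>V. f (c *\<^sub>R x) = c *\<^sub>R f x)"

definition tensor :: "('b \<Rightarrow>\<^sub>0 real) \<Rightarrow> ('c \<Rightarrow>\<^sub>0 real) \<Rightarrow> ('b \<times> 'c \<Rightarrow>\<^sub>0 real)"
  where "tensor x y = lin_ext (\<lambda>b. lin_ext (\<lambda>c. basis_vec (b, c)) y) x"

definition tensor_map ::
  "(('b \<Rightarrow>\<^sub>0 real) \<Rightarrow> ('c \<Rightarrow>\<^sub>0 real)) \<Rightarrow> (('b' \<Rightarrow>\<^sub>0 real) \<Rightarrow> ('c' \<Rightarrow>\<^sub>0 real)) \<Rightarrow>
    ('b \<times> 'b' \<Rightarrow>\<^sub>0 real) \<Rightarrow> ('c \<times> 'c' \<Rightarrow>\<^sub>0 real)"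
  where "tensor_map f g = lin_ext (\<lambda>(b, b'). tensor (f (basis_vec b)) (g (basis_vec b')))"


section \<open>Hopf monoids in species and their Hopf algebras\<close>

text \<open>
  Structure maps of a Hopf monoid \<open>H\<close> whose components \<open>H[U]\<close>, for finite \<open>U :: 'a set\<close>, are the
  spaces \<open>free_space (hm_basis H U)\<close>. The maps \<open>hm_mult H A B\<close> and \<open>hm_comult H A B\<close> matter only
  for disjoint finite \<open>A\<close>, \<open>B\<close>. The unit is given by its value at \<open>1\<close>, an element of \<open>H[{}]\<close>;
  the counit matters only on \<open>H[{}]\<close>; \<open>hm_relabel H \<sigma>\<close> is used as the map \<open>H[U] \<rightarrow> H[\<sigma> ` U]\<close> for
  any finite \<open>U\<close> on which \<open>\<sigma>\<close> is injective.
\<close>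

record ('a, 'b) hopf_monoid_data =
  hm_basis :: "'a set \<Rightarrow> 'b set"
  hm_relabel :: "('a \<Rightarrow> 'a) \<Rightarrow> ('b \<Rightarrow>\<^sub>0 real) \<Rightarrow> ('b \<Rightarrow>\<^sub>0 real)"
  hm_mult :: "'a set \<Rightarrow> 'a set \<Rightarrow> ('b \<times> 'b \<Rightarrow>\<^sub>0 real) \<Rightarrow> ('b \<Rightarrow>\<^sub>0 real)"
  hm_comult :: "'a set \<Rightarrow> 'a set \<Rightarrow> ('b \<Rightarrow>\<^sub>0 real) \<Rightarrow> ('b \<times> 'b \<Rightarrow>\<^sub>0 real)"
  hm_unit :: "'b \<Rightarrow>\<^sub>0 real"
  hm_counit :: "('b \<Rightarrow>\<^sub>0 real) \<Rightarrow> real"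

abbreviation hm_space :: "('a, 'b) hopf_monoid_data \<Rightarrow> 'a set \<Rightarrow> ('b \<Rightarrow>\<^sub>0 real) set"
  where "hm_space H U \<equiv> free_space (hm_basis H U)"

definition hopf_monoid_morphism ::
  "('a, 'b) hopf_monoid_data \<Rightarrow> ('a, 'c) hopf_monoid_data \<Rightarrow>
    ('a set \<Rightarrow> ('b \<Rightarrow>\<^sub>0 real) \<Rightarrow> ('c \<Rightarrow>\<^sub>0 real)) \<Rightarrow> bool"
  where "hopf_monoid_morphism H K \<phi> \<longleftrightarrow>
    (\<forall>U. finite U \<longrightarrow> linear_between (hm_space H U) (hm_space K U) (\<phi> U)) \<and>
    (\<forall>U V \<sigma>. finite U \<and> bij_betw \<sigma> U V \<longrightarrow>
      (\<forall>x\<in>hm_space H U. \<phi> V (hm_relabel H \<sigma> x) = hm_relabel K \<sigma> (\<phi> U x))) \<and>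
    (\<forall>A B. finite A \<and> finite B \<and> A \<inter> B = {} \<longrightarrow>
      (\<forall>z\<in>free_space (hm_basis H A \<times> hm_basis H B).
        \<phi> (A \<union> B) (hm_mult H A B z) = hm_mult K A B (tensor_map (\<phi> A) (\<phi> B) z))) \<and>
    (\<forall>A B. finite A \<and> finite B \<and> A \<inter> B = {} \<longrightarrow>
      (\<forall>x\<in>hm_space H (A \<union> B).
        hm_comult K A B (\<phi> (A \<union> B) x) = tensor_map (\<phi> A) (\<phi> B) (hm_comult H A B x))) \<and>
    \<phi> {} (hm_unit H) = hm_unit K \<and>
    (\<forall>x\<in>hm_space H {}. hm_counit K (\<phi> {} x) = hm_counit H x)"

record 'b hopf_algebra_data =
  ha_basis :: "'b set"
  ha_mult :: "('b \<times> 'b \<Rightarrow>\<^sub>0 real) \<Rightarrow> ('b \<Rightarrow>\<^sub>0 real)"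
  ha_comult :: "('b \<Rightarrow>\<^sub>0 real) \<Rightarrow> ('b \<times> 'b \<Rightarrow>\<^sub>0 real)"
  ha_unit :: "'b \<Rightarrow>\<^sub>0 real"
  ha_counit :: "('b \<Rightarrow>\<^sub>0 real) \<Rightarrow> real"

definition hopf_algebra_morphism ::
  "'b hopf_algebra_data \<Rightarrow> 'c hopf_algebra_data \<Rightarrow> (('b \<Rightarrow>\<^sub>0 real) \<Rightarrow> ('c \<Rightarrow>\<^sub>0 real)) \<Rightarrow> bool"
  where "hopf_algebra_morphism H K F \<longleftrightarrow>
    linear_between (free_space (ha_basis H)) (free_space (ha_basis K)) F \<and>
    (\<forall>z\<in>free_space (ha_basis H \<times> ha_basis H).
      F (ha_mult H z) = ha_mult K (tensor_map F F z)) \<and>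
    (\<forall>x\<in>free_space (ha_basis H). ha_comult K (F x) = tensor_map F F (ha_comult H x)) \<and>
    F (ha_unit H) = ha_unit K \<and>
    (\<forall>x\<in>free_space (ha_basis H). ha_counit K (F x) = ha_counit H x)"

text \<open>
  The direct sum of the \<open>H[{1..d}]\<close> is the free space on the disjoint union of their bases; an
  element \<open>(d, b)\<close> of that union is the basis element \<open>b\<close> of \<open>H[{1..d}]\<close>, and
  \<open>in_degree d\<close> is the inclusion of the \<open>d\<close>-th summand.
\<close>

definition in_degree :: "nat \<Rightarrow> ('b \<Rightarrow>\<^sub>0 real) \<Rightarrow> (nat \<times> 'b \<Rightarrow>\<^sub>0 real)"
  where "in_degree d = lin_ext (\<lambda>b. basis_vec (d, b))"

text \<open>On \<open>A\<close> this is the order-preserving bijection \<open>A \<rightarrow> {1..card A}\<close>.\<close>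

definition standardize :: "nat set \<Rightarrow> nat \<Rightarrow> nat"
  where "standardize A a = card {x \<in> A. x \<le> a}"

definition hopf_algebra_of :: "(nat, 'b) hopf_monoid_data \<Rightarrow> (nat \<times> 'b) hopf_algebra_data"
  where "hopf_algebra_of H =
    \<lparr> ha_basis = (SIGMA d:UNIV. hm_basis H {1..d}),
      ha_mult = lin_ext (\<lambda>((m, b), (n, c)).
        in_degree (m + n)
          (hm_mult H {1..m} {m+1..m+n}
            (tensor (basis_vec b) (hm_relabel H (\<lambda>i. m + i) (basis_vec c))))),
      ha_comult = lin_ext (\<lambda>(d, b).
        \<Sum>A\<in>Pow {1..d}. let B = {1..d} - A in
          tensor_map (in_degree (card A) \<circ> hm_relabel H (standardize A))
                     (in_degree (card B) \<circ> hm_relabel H (standardize B))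
                     (hm_comult H A B (basis_vec b))),
      ha_unit = in_degree 0 (hm_unit H),
      ha_counit = lin_ext (\<lambda>(d, b). if d = 0 then hm_counit H (basis_vec b) else 0) \<rparr>"

definition hopf_algebra_map ::
  "(nat set \<Rightarrow> ('b \<Rightarrow>\<^sub>0 real) \<Rightarrow> ('c \<Rightarrow>\<^sub>0 real)) \<Rightarrow>
    (nat \<times> 'b \<Rightarrow>\<^sub>0 real) \<Rightarrow> (nat \<times> 'c \<Rightarrow>\<^sub>0 real)"
  where "hopf_algebra_map \<phi> = lin_ext (\<lambda>(d, b). in_degree d (\<phi> {1..d} (basis_vec b)))"


section \<open>Matroids\<close>

datatype 'a indep_system = Indep_System (ground: "'a set") (indep: "'a set set")

definition matroid :: "'a indep_system \<Rightarrow> bool"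
  where "matroid M \<longleftrightarrow>
    finite (ground M) \<and> indep M \<subseteq> Pow (ground M) \<and> {} \<in> indep M \<and>
    (\<forall>I\<in>indep M. \<forall>J. J \<subseteq> I \<longrightarrow> J \<in> indep M) \<and>
    (\<forall>I\<in>indep M. \<forall>J\<in>indep M. card I < card J \<longrightarrow> (\<exists>x\<in>J - I. insert x I \<in> indep M))"

definition matroids_on :: "'a set \<Rightarrow> 'a indep_system set"
  where "matroids_on U = {M. matroid M \<and> ground M = U}"

definition bases :: "'a indep_system \<Rightarrow> 'a set set"
  where "bases M = {B \<in> indep M. \<forall>I\<in>indep M. B \<subseteq> I \<longrightarrow> I = B}"

definition direct_sum :: "'a indep_system \<Rightarrow> 'a indep_system \<Rightarrow> 'a indep_system"
  where "direct_sum M N =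
    Indep_System (ground M \<union> ground N) {I \<union> J |I J. I \<in> indep M \<and> J \<in> indep N}"

definition restriction :: "'a indep_system \<Rightarrow> 'a set \<Rightarrow> 'a indep_system"
  where "restriction M A = Indep_System A {I \<in> indep M. I \<subseteq> A}"

definition contraction :: "'a indep_system \<Rightarrow> 'a set \<Rightarrow> 'a indep_system"
  where "contraction M A =
    Indep_System (ground M - A)
      {I. I \<subseteq> ground M - A \<and> (\<exists>J\<in>bases (restriction M A). I \<union> J \<in> indep M)}"

definition matroid_image :: "('a \<Rightarrow> 'b) \<Rightarrow> 'a indep_system \<Rightarrow> 'b indep_system"
  where "matroid_image \<sigma> M = Indep_System (\<sigma> ` ground M) ((`) \<sigma> ` indep M)"

definition Mat_relabel ::
  "('a \<Rightarrow> 'b) \<Rightarrow> ('a indep_system \<Rightarrow>\<^sub>0 real) \<Rightarrow> ('b indep_system \<Rightarrow>\<^sub>0 real)"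
  where "Mat_relabel \<sigma> = lin_ext (\<lambda>M. basis_vec (matroid_image \<sigma> M))"

text \<open>\<open>Indep_System {} {{}}\<close> is the only matroid on the empty set.\<close>

definition Mat :: "('a, 'a indep_system) hopf_monoid_data"
  where "Mat =
    \<lparr> hm_basis = matroids_on,
      hm_relabel = Mat_relabel,
      hm_mult = (\<lambda>A B. lin_ext (\<lambda>(M, N). basis_vec (direct_sum M N))),
      hm_comult = (\<lambda>A B. lin_ext (\<lambda>M. basis_vec (restriction M A, contraction M A))),
      hm_unit = basis_vec (Indep_System {} {{}}),
      hm_counit = (\<lambda>x. Poly_Mapping.lookup x (Indep_System {} {{}})) \<rparr>"


section \<open>Set compositions\<close>

definition set_compositions :: "'a set \<Rightarrow> 'a set list set"
  where "set_compositions U = {p. partition_on U (set p) \<and> distinct p}"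

lemma finite_set_compositions: "finite U \<Longrightarrow> finite (set_compositions U)"
  by (rule finite_subset[OF _ finite_subset_distinct[of "Pow U"]])
    (auto simp: set_compositions_def partition_on_def)

definition comp_restrict :: "'a set list \<Rightarrow> 'a set \<Rightarrow> 'a set list"
  where "comp_restrict p A = filter (\<lambda>X. X \<noteq> {}) (map (\<lambda>X. X \<inter> A) p)"

definition comp_less :: "'a set list \<Rightarrow> 'a set \<Rightarrow> 'a set \<Rightarrow> bool"
  where "comp_less p A B \<longleftrightarrow>
    (\<forall>a\<in>A. \<forall>b\<in>B. \<forall>i<length p. \<forall>j<length p. a \<in> p ! i \<and> b \<in> p ! j \<longrightarrow> i < j)"

definition WQSym_relabel ::
  "('a \<Rightarrow> 'b) \<Rightarrow> ('a set list \<Rightarrow>\<^sub>0 real) \<Rightarrow> ('b set list \<Rightarrow>\<^sub>0 real)"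
  where "WQSym_relabel \<sigma> = lin_ext (\<lambda>p. basis_vec (map ((`) \<sigma>) p))"

definition WQSym :: "('a, 'a set list) hopf_monoid_data"
  where "WQSym =
    \<lparr> hm_basis = set_compositions,
      hm_relabel = WQSym_relabel,
      hm_mult = (\<lambda>A B. lin_ext (\<lambda>(t, s).
        \<Sum>p | p \<in> set_compositions (A \<union> B) \<and> comp_restrict p A = t \<and> comp_restrict p B = s.
          basis_vec p)),
      hm_comult = (\<lambda>A B. lin_ext (\<lambda>p.
        if comp_less p A B then basis_vec (comp_restrict p A, comp_restrict p B) else 0)),
      hm_unit = basis_vec [],
      hm_counit = (\<lambda>x. Poly_Mapping.lookup x []) \<rparr>"


section \<open>The map from matroids to set compositions\<close>

text \<open>The index of the part of \<open>p\<close> containing \<open>u\<close>, parts being numbered from \<open>1\<close>.\<close>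

definition comp_index :: "'a set list \<Rightarrow> 'a \<Rightarrow> nat"
  where "comp_index p u = Suc (THE i. i < length p \<and> u \<in> p ! i)"

text \<open>
  A set composition is \<open>M\<close>-generic if a unique basis of \<open>M\<close> \<^emph>\<open>minimizes\<close> the weight. This
  corrects the original wording, which has \<^emph>\<open>maximizes\<close>: with the latter, and all other
  definitions as here, compatibility with the coproducts is false. The orders \<open>A <\<^sub>\<pi> B\<close> in
  \<open>WQSym\<close> and \<open>M|\<^sub>A \<otimes> M/A\<close> in \<open>Mat\<close> require the greedy basis to be filled up from the early
  parts. For the uniform matroid \<open>M\<close> of rank one on \<open>{a, b, c}\<close> and maximal weights,
  \<open>({a}, {b, c})\<close> is not generic, as \<open>{b}\<close> and \<open>{c}\<close> tie, whereas \<open>({a})\<close> is generic for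
  \<open>M|\<^sub>A\<close> and \<open>({b, c})\<close> for the rank zero matroid \<open>M/A\<close>, where \<open>A = {a}\<close>. So
  \<open>({a}) \<otimes> ({b, c})\<close> has coefficient \<open>0\<close> on one side and \<open>1\<close> on the other. Reversing set
  compositions exchanges the two notions of genericity.
\<close>

definition generic :: "'a indep_system \<Rightarrow> 'a set list \<Rightarrow> bool"
  where "generic M p \<longleftrightarrow>
    (\<exists>!B. is_arg_min (\<lambda>B. \<Sum>u\<in>B. comp_index p u) (\<lambda>B. B \<in> bases M) B)"

definition Psi :: "'a set \<Rightarrow> ('a indep_system \<Rightarrow>\<^sub>0 real) \<Rightarrow> ('a set list \<Rightarrow>\<^sub>0 real)"
  where "Psi U = lin_ext (\<lambda>M. \<Sum>p | p \<in> set_compositions U \<and> generic M p. basis_vec p)"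

end

theory Submission
  imports Defs
begin

text \<open>
  A set composition is \<open>M\<close>-generic iff some basis \<open>B\<close> of \<open>M\<close> is such that every element outside \<open>B\<close>
  is spanned by the elements of \<open>B\<close> in strictly earlier parts. A basis of \<open>M \<oplus> N\<close> splits into bases of
  \<open>M\<close> and \<open>N\<close>, and the condition splits with it, so the generic \<open>p\<close> for \<open>M \<oplus> N\<close> are those with both
  restrictions generic, which is compatibility with the products. If \<open>A <\<^sub>p B\<close>, the elements of a
  greedy basis in \<open>A\<close> form a greedy basis of \<open>M|\<^sub>A\<close>, and the others one of \<open>M/A\<close>; since such \<open>p\<close> are
  exactly the concatenations of a composition of \<open>A\<close> and one of \<open>B\<close>, this is compatibility with the
  coproducts. The statement on Hopf algebras then holds for any morphism of Hopf monoids with linear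
  structure maps.
\<close>

section \<open>Linear maps between free spaces\<close>

text \<open>The spanning criterion is two exchange arguments. If an element \<open>y\<close> outside
  a minimal basis is not spanned by the strictly earlier elements of that basis, it can replace an
  element in its own or a later part. The weight does not grow, so the minimum is not unique.
  Conversely, let the criterion hold for \<open>B\<close>, and let \<open>B'\<close> be another
  minimal basis with \<open>y\<close> in \<open>B'\<close> but not in \<open>B\<close>. Some
  strictly earlier element of \<open>B\<close> can replace \<open>y\<close> in \<open>B'\<close>,
  and the weight drops. A minimum exists anyway, since there are finitely many bases. On basis
  vectors, each structural identity compares two finite sums of basis vectors. For relabelling and
  coproducts, a bijection of the index sets suffices. For products, the compositions are grouped by
  their pair of restrictions. A composition without \<open>comp_less p A B\<close> has coproduct
  zero, and no concatenation of a composition of \<open>A\<close> with one of \<open>B\<close> is of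
  that kind. In the Hopf algebras the new ingredients are the shift by \<open>m\<close> and the
  standardizations. Both are bijections between finite sets, so naturality moves the morphism past
  them.\<close>

lemma lookup_scaleR [simp]:
  "Poly_Mapping.lookup (r *\<^sub>R x) i = r *\<^sub>R Poly_Mapping.lookup x i"
  for x :: "'b \<Rightarrow>\<^sub>0 'v::real_vector"
proof -
  \<comment> \<open>Scaling is defined through \<open>Abs_poly_mapping\<close>, which
    \<open>lookup\<close> inverts only once the support is known to be finite.\<close>
  have "finite {i. r *\<^sub>R Poly_Mapping.lookup x i \<noteq> 0}"
    by (rule finite_subset[OF _ finite_lookup[of x]]) auto
  then show ?thesis
    by (simp add: scaleR_poly_mapping_def)
qed

text \<open>The index set in \<open>lin_ext\<close> depends on the argument. Over a common finite
  superset of the keys, the sums for different arguments can be combined termwise.\<close>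

lemma lin_ext_eq_sum:
  assumes "finite S" "Poly_Mapping.keys x \<subseteq> S"
  shows "lin_ext f x = (\<Sum>b\<in>S. Poly_Mapping.lookup x b *\<^sub>R f b)"
  unfolding lin_ext_def
  by (rule sum.mono_neutral_left) (use assms in \<open>auto simp: in_keys_iff\<close>)

lemma linear_lin_ext: "linear (lin_ext f)"
proof (rule linearI)
  fix x y :: "'a \<Rightarrow>\<^sub>0 real"
  let ?S = "Poly_Mapping.keys x \<union> Poly_Mapping.keys y"
  have "Poly_Mapping.keys (x + y) \<subseteq> ?S"
    by (rule keys_add)
  then have "lin_ext f (x + y) = (\<Sum>b\<in>?S. Poly_Mapping.lookup (x + y) b *\<^sub>R f b)"
    by (intro lin_ext_eq_sum) auto
  also have "\<dots> = lin_ext f x + lin_ext f y"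
    by (simp add: lin_ext_eq_sum[of ?S] lookup_add scaleR_add_left sum.distrib)
  finally show "lin_ext f (x + y) = lin_ext f x + lin_ext f y" .
next
  fix r and x :: "'a \<Rightarrow>\<^sub>0 real"
  have "Poly_Mapping.keys (r *\<^sub>R x) \<subseteq> Poly_Mapping.keys x"
    by (auto simp: in_keys_iff)
  then have "lin_ext f (r *\<^sub>R x) =
      (\<Sum>b\<in>Poly_Mapping.keys x. Poly_Mapping.lookup (r *\<^sub>R x) b *\<^sub>R f b)"
    by (intro lin_ext_eq_sum) auto
  then show "lin_ext f (r *\<^sub>R x) = r *\<^sub>R lin_ext f x"
    by (simp add: lin_ext_def scaleR_sum_right)
qed

lemma lin_ext_basis_vec [simp]: "lin_ext f (basis_vec b) = f b"
  by (simp add: lin_ext_def)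

lemma lin_ext_basis_vec_id: "lin_ext basis_vec x = x"
  by (rule poly_mapping_eqI)
    (auto simp: lin_ext_def lookup_sum lookup_single when_def if_distrib in_keys_iff cong: if_cong)

text \<open>The identities for relabelling, products, coproducts and counits are all proved through
  this reduction. Both sides are linear on the whole type, while agreement is known only for basis
  vectors in \<open>X\<close>.\<close>

lemma linear_eq_on_free_space:
  assumes "linear f" "linear g" "x \<in> free_space X"
    and "\<And>b. b \<in> X \<Longrightarrow> f (basis_vec b) = g (basis_vec b)"
  shows "f x = g x"
proof -
  have x: "x = (\<Sum>b\<in>Poly_Mapping.keys x. Poly_Mapping.lookup x b *\<^sub>R basis_vec b)"
    using lin_ext_basis_vec_id[of x] by (simp add: lin_ext_def)
  have "f x = (\<Sum>b\<in>Poly_Mapping.keys x. Poly_Mapping.lookup x b *\<^sub>R f (basis_vec b))"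
    by (subst x) (simp add: linear_sum[OF assms(1)] linear_scale[OF assms(1)])
  also have "\<dots> = (\<Sum>b\<in>Poly_Mapping.keys x. Poly_Mapping.lookup x b *\<^sub>R g (basis_vec b))"
    using assms(3,4) by (intro sum.cong) (auto simp: free_space_def)
  also have "\<dots> = g x"
    by (subst (3) x) (simp add: linear_sum[OF assms(2)] linear_scale[OF assms(2)])
  finally show ?thesis .
qed

lemma free_space_UNIV: "x \<in> free_space UNIV"
  by (simp add: free_space_def)

lemma linear_eq_on_basis:
  assumes "linear f" "linear g" "\<And>b. f (basis_vec b) = g (basis_vec b)"
  shows "f x = g x"
  using linear_eq_on_free_space[OF assms(1,2) free_space_UNIV] assms(3) by blast

lemma subspace_free_space: "subspace (free_space X)"
  by (auto simp: subspace_def free_space_def in_keys_iff lookup_add subset_iff) (metis add_0)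

lemma basis_vec_in_free_space [simp]: "basis_vec b \<in> free_space X \<longleftrightarrow> b \<in> X"
  by (simp add: free_space_def)

lemma sum_in_free_space: "(\<And>i. i \<in> I \<Longrightarrow> f i \<in> free_space X) \<Longrightarrow> sum f I \<in> free_space X"
  by (rule subspace_sum[OF subspace_free_space])

lemma linear_maps_free_space:
  assumes "linear f" "x \<in> free_space X" "\<And>b. b \<in> X \<Longrightarrow> f (basis_vec b) \<in> free_space Y"
  shows "f x \<in> free_space Y"
proof -
  have x: "x = (\<Sum>b\<in>Poly_Mapping.keys x. Poly_Mapping.lookup x b *\<^sub>R basis_vec b)"
    using lin_ext_basis_vec_id[of x] by (simp add: lin_ext_def)
  have "f x = (\<Sum>b\<in>Poly_Mapping.keys x. Poly_Mapping.lookup x b *\<^sub>R f (basis_vec b))"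
    by (subst x) (simp add: linear_sum[OF assms(1)] linear_scale[OF assms(1)])
  also have "\<dots> \<in> free_space Y"
    using assms(2,3)
    by (intro sum_in_free_space subspace_scale[OF subspace_free_space]) (auto simp: free_space_def)
  finally show ?thesis .
qed

lemma linear_betweenI:
  assumes "linear f" "\<And>b. b \<in> X \<Longrightarrow> f (basis_vec b) \<in> free_space Y"
  shows "linear_between (free_space X) (free_space Y) f"
  using linear_maps_free_space[OF assms(1) _ assms(2)]
  by (auto simp: linear_between_def linear_add[OF assms(1)] linear_scale[OF assms(1)])

lemma linear_comp: "linear f \<Longrightarrow> linear g \<Longrightarrow> linear (\<lambda>x. f (g x))"
  using linear_compose[of g f] by (simp add: comp_def)

text \<open>In \<open>tensor\<close> the second factor sits inside the function that the outer
  \<open>lin_ext\<close> extends, so linearity in that factor is linearity of \<open>lin_ext\<close>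
  in its function.\<close>

lemma linear_lin_ext_parameter:
  assumes "\<And>b. linear (\<lambda>x. f x b)"
  shows "linear (\<lambda>x. lin_ext (f x) z)"
  unfolding lin_ext_def
  by (intro linear_compose_sum ballI) (intro linear_compose_scale_right assms)

section \<open>Tensor products of vectors and of linear maps\<close>

lemma linear_tensor_left: "linear (\<lambda>x. tensor x y)"
  unfolding tensor_def by (rule linear_lin_ext)

lemma linear_tensor_right: "linear (tensor x)"
  unfolding tensor_def by (intro linear_lin_ext_parameter linear_lin_ext)

lemma tensor_basis_vec [simp]: "tensor (basis_vec b) (basis_vec c) = basis_vec (b, c)"
  by (simp add: tensor_def)

lemma tensor_sum:
  "tensor (\<Sum>i\<in>I. f i) (\<Sum>j\<in>J. g j) = (\<Sum>(i, j)\<in>I \<times> J. tensor (f i) (g j))"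
  by (subst linear_sum[OF linear_tensor_left])
    (simp add: linear_sum[OF linear_tensor_right] sum.cartesian_product)

lemma tensor_in_free_space:
  assumes "x \<in> free_space X" "y \<in> free_space Y"
  shows "tensor x y \<in> free_space (X \<times> Y)"
  by (rule linear_maps_free_space[OF linear_tensor_left assms(1)],
      rule linear_maps_free_space[OF linear_tensor_right assms(2)]) simp

lemma linear_tensor_map: "linear (tensor_map f g)"
  unfolding tensor_map_def by (rule linear_lin_ext)

lemma tensor_map_basis_vec [simp]:
  "tensor_map f g (basis_vec (b, c)) = tensor (f (basis_vec b)) (g (basis_vec c))"
  by (simp add: tensor_map_def)

lemma bilinear_eq_on_basis:
  assumes "\<And>y. linear (\<lambda>x. f x y)" "\<And>x. linear (f x)"
    and "\<And>y. linear (\<lambda>x. g x y)" "\<And>x. linear (g x)"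
    and "\<And>b c. f (basis_vec b) (basis_vec c) = g (basis_vec b) (basis_vec c)"
  shows "f x y = g x y"
proof (rule linear_eq_on_basis[where f = "\<lambda>x. f x y" and g = "\<lambda>x. g x y"])
  show "f (basis_vec b) y = g (basis_vec b) y" for b
    by (rule linear_eq_on_basis) (use assms in auto)
qed (use assms in auto)

lemma tensor_map_tensor:
  assumes "linear f" "linear g"
  shows "tensor_map f g (tensor x y) = tensor (f x) (g y)"
  by (rule bilinear_eq_on_basis[where f = "\<lambda>x y. tensor_map f g (tensor x y)"
        and g = "\<lambda>x y. tensor (f x) (g y)"])
    (use assms in \<open>auto intro: linear_comp[OF linear_tensor_map] linear_tensor_left
      linear_tensor_right linear_comp[OF linear_tensor_left] linear_comp[OF linear_tensor_right]\<close>)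

lemma tensor_map_tensor_map:
  assumes "linear f" "linear g"
  shows "tensor_map f g (tensor_map f' g' z) = tensor_map (f \<circ> f') (g \<circ> g') z"
proof (rule linear_eq_on_basis[where f = "\<lambda>z. tensor_map f g (tensor_map f' g' z)"])
  show "tensor_map f g (tensor_map f' g' (basis_vec b)) =
      tensor_map (f \<circ> f') (g \<circ> g') (basis_vec b)" for b
    by (cases b) (simp add: tensor_map_tensor assms)
qed (rule linear_comp[OF linear_tensor_map linear_tensor_map] linear_tensor_map)+

text \<open>\<open>tensor_map\<close> sees its two maps only through their values at basis vectors.
  This fits naturality, which is known only on the spaces of a Hopf monoid and not on the whole
  type.\<close>

lemma tensor_map_cong_free_space:
  assumes "z \<in> free_space (X \<times> Y)"
    and "\<And>b. b \<in> X \<Longrightarrow> f (basis_vec b) = f' (basis_vec b)"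
    and "\<And>c. c \<in> Y \<Longrightarrow> g (basis_vec c) = g' (basis_vec c)"
  shows "tensor_map f g z = tensor_map f' g' z"
  by (rule linear_eq_on_free_space[OF linear_tensor_map linear_tensor_map assms(1)])
    (use assms(2,3) in auto)


section \<open>From Hopf monoids to Hopf algebras\<close>

lemma linear_in_degree: "linear (in_degree d)"
  unfolding in_degree_def by (rule linear_lin_ext)

lemma in_degree_basis_vec [simp]: "in_degree d (basis_vec b) = basis_vec (d, b)"
  by (simp add: in_degree_def)

lemma linear_hopf_algebra_map: "linear (hopf_algebra_map \<phi>)"
  unfolding hopf_algebra_map_def by (rule linear_lin_ext)

lemma hopf_algebra_map_in_degree:
  assumes "linear (\<phi> {1..d})"
  shows "hopf_algebra_map \<phi> (in_degree d x) = in_degree d (\<phi> {1..d} x)"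
proof (rule linear_eq_on_basis[where f = "\<lambda>x. hopf_algebra_map \<phi> (in_degree d x)"])
  show "hopf_algebra_map \<phi> (in_degree d (basis_vec b)) = in_degree d (\<phi> {1..d} (basis_vec b))" for b
    by (simp add: hopf_algebra_map_def)
qed (rule linear_comp[OF linear_hopf_algebra_map linear_in_degree]
    linear_comp[OF linear_in_degree assms])+

text \<open>The map is strictly increasing on \<open>A\<close>, hence injective, and its values lie
  in a set with \<open>card A\<close> elements; surjectivity follows by counting.\<close>

lemma bij_betw_standardize:
  assumes "finite A"
  shows "bij_betw (standardize A) A {1..card A}"
proof -
  have less: "standardize A a < standardize A b" if "a \<in> A" "b \<in> A" "a < b" for a b
  proof -
    have "b \<in> {x \<in> A. x \<le> b}" "b \<notin> {x \<in> A. x \<le> a}"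
      using that by auto
    then have "{x \<in> A. x \<le> a} \<subset> {x \<in> A. x \<le> b}"
      using that by fastforce
    then show ?thesis
      unfolding standardize_def by (rule psubset_card_mono[rotated]) (use assms in auto)
  qed
  have inj: "inj_on (standardize A) A"
    by (rule inj_onI) (metis less less_irrefl linorder_neqE_nat)
  have "standardize A a \<in> {1..card A}" if "a \<in> A" for a
    using that assms
    by (auto simp: standardize_def Suc_le_eq card_gt_0_iff intro: card_mono)
  then have "standardize A ` A = {1..card A}"
    by (intro card_subset_eq) (auto simp: card_image[OF inj])
  with inj show ?thesis
    by (simp add: bij_betw_def)
qed

text \<open>The record of structure maps carries no axioms. Linearity is what extends the formulas
  in \<open>hopf_algebra_of\<close>, given on basis elements, to all homogeneous elements.\<close>

locale linear_hopf_monoid_data =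
  fixes H :: "(nat, 'b) hopf_monoid_data"
  assumes linear_relabel: "linear (hm_relabel H \<sigma>)"
    and linear_mult: "linear (hm_mult H A B)"
    and linear_comult: "linear (hm_comult H A B)"
    and linear_counit: "linear (hm_counit H)"
begin

text \<open>Needed because a morphism sends a basis vector to a combination of several, so the
  product must be known for arbitrary \<open>x\<close> and \<open>y\<close>. The formulas for
  coproduct and counit below serve the same end.\<close>

lemma ha_mult_in_degree:
  "ha_mult (hopf_algebra_of H) (tensor (in_degree m x) (in_degree n y)) =
    in_degree (m + n)
      (hm_mult H {1..m} {m+1..m+n} (tensor x (hm_relabel H (\<lambda>i. m + i) y)))"
  by (rule bilinear_eq_on_basis[where
        f = "\<lambda>x y. ha_mult (hopf_algebra_of H) (tensor (in_degree m x) (in_degree n y))" and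
        g = "\<lambda>x y. in_degree (m + n)
          (hm_mult H {1..m} {m+1..m+n} (tensor x (hm_relabel H (\<lambda>i. m + i) y)))"])
    (auto simp: hopf_algebra_of_def intro!: linear_comp[OF linear_lin_ext]
      linear_comp[OF linear_tensor_left] linear_comp[OF linear_tensor_right] linear_in_degree
      linear_comp[OF linear_in_degree] linear_comp[OF linear_mult] linear_relabel
      linear_tensor_left)

lemma linear_ha_comult: "linear (ha_comult (hopf_algebra_of H))"
  by (simp add: hopf_algebra_of_def linear_lin_ext)

lemma linear_ha_counit: "linear (ha_counit (hopf_algebra_of H))"
  by (simp add: hopf_algebra_of_def linear_lin_ext)

lemma linear_ha_mult: "linear (ha_mult (hopf_algebra_of H))"
  by (simp add: hopf_algebra_of_def linear_lin_ext)

lemma ha_comult_in_degree: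
  "ha_comult (hopf_algebra_of H) (in_degree d x) =
    (\<Sum>A\<in>Pow {1..d}.
      tensor_map (in_degree (card A) \<circ> hm_relabel H (standardize A))
        (in_degree (card ({1..d} - A)) \<circ> hm_relabel H (standardize ({1..d} - A)))
        (hm_comult H A ({1..d} - A) x))"
  by (rule linear_eq_on_basis[where f = "\<lambda>x. ha_comult (hopf_algebra_of H) (in_degree d x)"])
    (auto simp: hopf_algebra_of_def Let_def o_def
      intro!: linear_comp[OF linear_lin_ext] linear_in_degree linear_compose_sum
        linear_comp[OF linear_tensor_map] linear_comult)

lemma ha_counit_in_degree:
  "ha_counit (hopf_algebra_of H) (in_degree d x) = (if d = 0 then hm_counit H x else 0)"
  by (cases "d = 0"; rule linear_eq_on_basis[where
        f = "\<lambda>x. ha_counit (hopf_algebra_of H) (in_degree d x)"])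
    (auto simp: hopf_algebra_of_def
      intro!: linear_comp[OF linear_lin_ext] linear_in_degree linear_counit linear_zero)

end

text \<open>The laws in \<open>hopf_monoid_morphism\<close> hold only on the spaces of
  \<open>H\<close>. The last two assumptions keep the relabelled second factor of a product and both
  components of a coproduct inside those spaces, so that the laws apply. Linearity of
  \<open>\<phi> U\<close> on the whole type is assumed separately because the lemmas on
  \<open>tensor_map\<close> ask for it.\<close>

lemma hopf_algebra_morphism_hopf_algebra_map:
  fixes H :: "(nat, 'b) hopf_monoid_data" and K :: "(nat, 'c) hopf_monoid_data"
  assumes H: "linear_hopf_monoid_data H" and K: "linear_hopf_monoid_data K"
    and mor: "hopf_monoid_morphism H K \<phi>" and lin: "\<And>U. linear (\<phi> U)"
    and relabel: "\<And>\<sigma> U V b. finite U \<Longrightarrow> bij_betw \<sigma> U V \<Longrightarrow> b \<in> hm_basis H U \<Longrightarrow>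
      hm_relabel H \<sigma> (basis_vec b) \<in> hm_space H V"
    and comult: "\<And>A B b. finite A \<Longrightarrow> finite B \<Longrightarrow> A \<inter> B = {} \<Longrightarrow> b \<in> hm_basis H (A \<union> B) \<Longrightarrow>
      hm_comult H A B (basis_vec b) \<in> free_space (hm_basis H A \<times> hm_basis H B)"
  shows "hopf_algebra_morphism (hopf_algebra_of H) (hopf_algebra_of K) (hopf_algebra_map \<phi>)"
proof -
  interpret H: linear_hopf_monoid_data H by (rule H)
  interpret K: linear_hopf_monoid_data K by (rule K)
  let ?HA = "hopf_algebra_of H" and ?KA = "hopf_algebra_of K" and ?F = "hopf_algebra_map \<phi>"
  have map: "\<phi> U ` hm_space H U \<subseteq> hm_space K U" if "finite U" for U
    using mor that by (auto simp: hopf_monoid_morphism_def linear_between_def)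
  have nat: "\<phi> V (hm_relabel H \<sigma> x) = hm_relabel K \<sigma> (\<phi> U x)"
    if "finite U" "bij_betw \<sigma> U V" "x \<in> hm_space H U" for U V \<sigma> x
    using mor that by (simp add: hopf_monoid_morphism_def)
  have mult: "\<phi> (A \<union> B) (hm_mult H A B z) = hm_mult K A B (tensor_map (\<phi> A) (\<phi> B) z)"
    if "finite A" "finite B" "A \<inter> B = {}" "z \<in> free_space (hm_basis H A \<times> hm_basis H B)" for A B z
    using mor that by (simp add: hopf_monoid_morphism_def)
  have cmult: "hm_comult K A B (\<phi> (A \<union> B) x) = tensor_map (\<phi> A) (\<phi> B) (hm_comult H A B x)"
    if "finite A" "finite B" "A \<inter> B = {}" "x \<in> hm_space H (A \<union> B)" for A B x
    using mor that by (simp add: hopf_monoid_morphism_def)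
  have F: "?F (in_degree d x) = in_degree d (\<phi> {1..d} x)" for d x
    by (rule hopf_algebra_map_in_degree[OF lin])
  have Fb: "?F (basis_vec (d, b)) = in_degree d (\<phi> {1..d} (basis_vec b))" for d b
    by (simp add: hopf_algebra_map_def)
  have basis: "(d, b) \<in> ha_basis ?HA \<longleftrightarrow> b \<in> hm_basis H {1..d}" for d b
    by (simp add: hopf_algebra_of_def)

  have linF: "linear_between (free_space (ha_basis ?HA)) (free_space (ha_basis ?KA)) ?F"
  proof (rule linear_betweenI[OF linear_hopf_algebra_map])
    fix b assume b: "b \<in> ha_basis ?HA"
    obtain d c where dc: "b = (d, c)" by (cases b)
    have "\<phi> {1..d} (basis_vec c) \<in> hm_space K {1..d}"
      using map[of "{1..d}"] b dc basis by fastforce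
    then show "?F (basis_vec b) \<in> free_space (ha_basis ?KA)"
      unfolding dc Fb
      by (rule linear_maps_free_space[OF linear_in_degree]) (simp add: hopf_algebra_of_def)
  qed

  have multF: "?F (ha_mult ?HA z) = ha_mult ?KA (tensor_map ?F ?F z)"
    if z: "z \<in> free_space (ha_basis ?HA \<times> ha_basis ?HA)" for z
  proof (rule linear_eq_on_free_space[OF _ _ z])
    fix p assume "p \<in> ha_basis ?HA \<times> ha_basis ?HA"
    then obtain m b n c where p: "p = ((m, b), (n, c))"
      and b: "b \<in> hm_basis H {1..m}" and c: "c \<in> hm_basis H {1..n}"
      using basis by (cases p) auto
    let ?A = "{1..m}" and ?B = "{m+1..m+n}"
    have AB: "?A \<union> ?B = {1..m+n}" "?A \<inter> ?B = {}" by auto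
    have bij: "bij_betw (\<lambda>i. m + i) {1..n} ?B"
      by (rule bij_betwI[where g = "\<lambda>i. i - m"]) auto
    let ?c = "hm_relabel H (\<lambda>i. m + i) (basis_vec c)"
    have c': "?c \<in> hm_space H ?B"
      by (rule relabel[OF _ bij c]) simp
    have "?F (ha_mult ?HA (basis_vec p)) =
        ?F (ha_mult ?HA (tensor (in_degree m (basis_vec b)) (in_degree n (basis_vec c))))"
      by (simp add: p)
    also have "\<dots> = in_degree (m + n) (\<phi> (?A \<union> ?B) (hm_mult H ?A ?B (tensor (basis_vec b) ?c)))"
      by (simp only: H.ha_mult_in_degree F AB)
    also have "\<phi> (?A \<union> ?B) (hm_mult H ?A ?B (tensor (basis_vec b) ?c)) =
        hm_mult K ?A ?B (tensor (\<phi> ?A (basis_vec b)) (\<phi> ?B ?c))"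
    proof -
      have "tensor (basis_vec b) ?c \<in> free_space (hm_basis H ?A \<times> hm_basis H ?B)"
        by (rule tensor_in_free_space) (use b c' in auto)
      then show ?thesis
        using mult[of ?A ?B "tensor (basis_vec b) ?c"] AB(2)
        by (simp only: tensor_map_tensor[OF lin lin] finite_atLeastAtMost)
    qed
    \<comment> \<open>Naturality for the shift, a bijection of \<open>{1..n}\<close> onto the second
      block.\<close>
    also have "\<phi> ?B ?c = hm_relabel K (\<lambda>i. m + i) (\<phi> {1..n} (basis_vec c))"
      by (rule nat[OF _ bij]) (use c in auto)
    also have "in_degree (m + n) (hm_mult K ?A ?B (tensor (\<phi> ?A (basis_vec b)) \<dots>)) =
        ha_mult ?KA (tensor (?F (basis_vec (m, b))) (?F (basis_vec (n, c))))"
      by (simp only: Fb K.ha_mult_in_degree)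
    finally show "?F (ha_mult ?HA (basis_vec p)) = ha_mult ?KA (tensor_map ?F ?F (basis_vec p))"
      by (simp add: p)
  qed (rule linear_comp[OF linear_hopf_algebra_map H.linear_ha_mult]
      linear_comp[OF K.linear_ha_mult linear_tensor_map])+

  have comultF: "ha_comult ?KA (?F x) = tensor_map ?F ?F (ha_comult ?HA x)"
    if x: "x \<in> free_space (ha_basis ?HA)" for x
  proof (rule linear_eq_on_free_space[OF _ _ x])
    fix p assume "p \<in> ha_basis ?HA"
    then obtain d b where p: "p = (d, b)" and b: "b \<in> hm_basis H {1..d}"
      using basis by (cases p) auto
    define h where "h A = in_degree (card A) \<circ> hm_relabel H (standardize A)" for A
    define k where "k A = in_degree (card A) \<circ> hm_relabel K (standardize A)" for A
    have linh: "linear (h A)" and link: "linear (k A)" for A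
      unfolding h_def k_def
      by (intro linear_compose linear_in_degree H.linear_relabel K.linear_relabel)+
    \<comment> \<open>Naturality for the bijection \<open>standardize A\<close>, followed by the
      inclusion in degree \<open>card A\<close>.\<close>
    have kh: "k A (\<phi> A (basis_vec c)) = ?F (h A (basis_vec c))"
      if "finite A" "c \<in> hm_basis H A" for A c
      unfolding h_def k_def o_def F
      using nat[OF that(1) bij_betw_standardize[OF that(1)], of "basis_vec c"] that(2) by simp
    have "ha_comult ?KA (?F (basis_vec p)) =
        (\<Sum>A\<in>Pow {1..d}. tensor_map (k A) (k ({1..d} - A))
          (hm_comult K A ({1..d} - A) (\<phi> {1..d} (basis_vec b))))"
      by (simp only: p Fb K.ha_comult_in_degree k_def)
    also have "\<dots> = (\<Sum>A\<in>Pow {1..d}. tensor_map ?F ?F (tensor_map (h A) (h ({1..d} - A))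
          (hm_comult H A ({1..d} - A) (basis_vec b))))"
    proof (rule sum.cong[OF refl])
      fix A assume "A \<in> Pow {1..d}"
      then have A: "finite A" "A \<union> ({1..d} - A) = {1..d}"
        by (auto intro: finite_subset)
      let ?B = "{1..d} - A"
      have "hm_comult K A ?B (\<phi> {1..d} (basis_vec b)) =
          tensor_map (\<phi> A) (\<phi> ?B) (hm_comult H A ?B (basis_vec b))"
        using cmult[of A ?B "basis_vec b"] A b by simp
      moreover have "hm_comult H A ?B (basis_vec b) \<in> free_space (hm_basis H A \<times> hm_basis H ?B)"
        using comult[of A ?B b] A b by simp
      ultimately show "tensor_map (k A) (k ?B) (hm_comult K A ?B (\<phi> {1..d} (basis_vec b))) =
          tensor_map ?F ?F (tensor_map (h A) (h ?B) (hm_comult H A ?B (basis_vec b)))"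
        using A(1) by (auto simp: tensor_map_tensor_map link linear_hopf_algebra_map kh
            intro: tensor_map_cong_free_space)
    qed
    also have "\<dots> = tensor_map ?F ?F (ha_comult ?HA (in_degree d (basis_vec b)))"
      by (simp only: H.ha_comult_in_degree h_def linear_sum[OF linear_tensor_map])
    finally show "ha_comult ?KA (?F (basis_vec p)) = tensor_map ?F ?F (ha_comult ?HA (basis_vec p))"
      by (simp add: p)
  qed (rule linear_comp[OF linear_tensor_map H.linear_ha_comult]
      linear_comp[OF K.linear_ha_comult linear_hopf_algebra_map])+

  have unitF: "?F (ha_unit ?HA) = ha_unit ?KA"
    using mor F[of 0 "hm_unit H"] by (simp add: hopf_algebra_of_def hopf_monoid_morphism_def)

  have counitF: "ha_counit ?KA (?F x) = ha_counit ?HA x"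
    if x: "x \<in> free_space (ha_basis ?HA)" for x
  proof (rule linear_eq_on_free_space[OF _ _ x])
    fix p assume "p \<in> ha_basis ?HA"
    then obtain d b where p: "p = (d, b)" and b: "b \<in> hm_basis H {1..d}"
      using basis by (cases p) auto
    \<comment> \<open>For \<open>d = 0\<close> the set \<open>{1..d}\<close> is empty and the counit
      law of the morphism applies; for \<open>d > 0\<close> both counits vanish.\<close>
    have "hm_counit K (\<phi> {} (basis_vec b)) = hm_counit H (basis_vec b)" if "d = 0"
      using mor b that by (simp add: hopf_monoid_morphism_def)
    then show "ha_counit ?KA (?F (basis_vec p)) = ha_counit ?HA (basis_vec p)"
      using H.ha_counit_in_degree[of d "basis_vec b"]
        K.ha_counit_in_degree[of d "\<phi> {1..d} (basis_vec b)"]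
      by (auto simp: p Fb)
  qed (rule H.linear_ha_counit linear_comp[OF K.linear_ha_counit linear_hopf_algebra_map])+

  show ?thesis
    using linF multF comultF unitF counitF by (simp add: hopf_algebra_morphism_def)
qed


section \<open>Matroids and greedy bases\<close>

lemma matroidD:
  assumes "matroid M"
  shows "finite (ground M)" "indep M \<subseteq> Pow (ground M)" "{} \<in> indep M"
    "\<And>I J. I \<in> indep M \<Longrightarrow> J \<subseteq> I \<Longrightarrow> J \<in> indep M"
    "\<And>I J. I \<in> indep M \<Longrightarrow> J \<in> indep M \<Longrightarrow> card I < card J \<Longrightarrow> \<exists>x\<in>J - I. insert x I \<in> indep M"
  using assms by (auto simp: matroid_def)

lemma matroidI:
  assumes "finite (ground M)" "indep M \<subseteq> Pow (ground M)" "{} \<in> indep M"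
    "\<And>I J. I \<in> indep M \<Longrightarrow> J \<subseteq> I \<Longrightarrow> J \<in> indep M"
    "\<And>I J. I \<in> indep M \<Longrightarrow> J \<in> indep M \<Longrightarrow> card I < card J \<Longrightarrow> \<exists>x\<in>J - I. insert x I \<in> indep M"
  shows "matroid M"
  using assms unfolding matroid_def by (intro conjI ballI allI impI)

lemma indep_finite:
  assumes "matroid M" "I \<in> indep M"
  shows "finite I" "I \<subseteq> ground M"
  using assms by (auto simp: matroid_def intro: finite_subset)

lemma finite_indep: "matroid M \<Longrightarrow> finite (indep M)"
  by (rule finite_subset[of _ "Pow (ground M)"]) (auto simp: matroid_def)

text \<open>Iterated exchange, by induction on the number of elements still missing.\<close>

lemma indep_augment:
  assumes M: "matroid M" and J: "J \<in> indep M"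
  shows "I \<in> indep M \<Longrightarrow> card I \<le> card J \<Longrightarrow>
    \<exists>K\<in>indep M. I \<subseteq> K \<and> K \<subseteq> I \<union> J \<and> card K = card J"
proof (induction "card J - card I" arbitrary: I)
  case 0
  then show ?case by (intro bexI[of _ I]) auto
next
  case (Suc n)
  then have "card I < card J" by linarith
  then obtain x where x: "x \<in> J - I" "insert x I \<in> indep M"
    using matroidD(5)[OF M Suc.prems(1) J] by auto
  have "card (insert x I) = Suc (card I)"
    using x(1) indep_finite(1)[OF M Suc.prems(1)] by simp
  then have "n = card J - card (insert x I)" "card (insert x I) \<le> card J"
    using Suc.hyps(2) \<open>card I < card J\<close> by linarith+
  then obtain K where "K \<in> indep M" "insert x I \<subseteq> K" "K \<subseteq> insert x I \<union> J" "card K = card J"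
    using Suc.hyps(1)[OF _ x(2)] by blast
  then show ?case using x(1) by (intro bexI[of _ K]) auto
qed

text \<open>A larger independent set would supply, by exchange, an element to add, so maximality
  under inclusion already forces maximal size.\<close>

lemma bases_iff:
  assumes M: "matroid M"
  shows "B \<in> bases M \<longleftrightarrow> B \<in> indep M \<and> (\<forall>I\<in>indep M. card I \<le> card B)"
proof
  assume B: "B \<in> bases M"
  then have Bi: "B \<in> indep M" by (simp add: bases_def)
  have "card I \<le> card B" if I: "I \<in> indep M" for I
  proof (rule ccontr)
    assume "\<not> card I \<le> card B"
    then obtain x where "x \<in> I - B" "insert x B \<in> indep M"
      using matroidD(5)[OF M Bi I] by auto
    then show False using B by (auto simp: bases_def)
  qed
  with Bi show "B \<in> indep M \<and> (\<forall>I\<in>indep M. card I \<le> card B)" by blast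
next
  assume "B \<in> indep M \<and> (\<forall>I\<in>indep M. card I \<le> card B)"
  then show "B \<in> bases M"
    unfolding bases_def by (auto dest: indep_finite[OF M] card_seteq)
qed

text \<open>A proper independent extension can be cut down to an extension by one element, because
  subsets of independent sets are independent. In this form bases of direct sums and of minors are
  compared element by element.\<close>

lemma bases_iff_insert:
  assumes M: "matroid M"
  shows "B \<in> bases M \<longleftrightarrow> B \<in> indep M \<and> (\<forall>y\<in>ground M - B. insert y B \<notin> indep M)"
proof -
  have "I = B" if *: "\<forall>y\<in>ground M - B. insert y B \<notin> indep M" and I: "I \<in> indep M" "B \<subseteq> I" for I
  proof (rule ccontr)
    assume "I \<noteq> B"
    then obtain y where y: "y \<in> I" "y \<notin> B" using I(2) by auto
    then have "insert y B \<in> indep M"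
      using I by (intro matroidD(4)[OF M I(1)]) auto
    then show False using * y indep_finite(2)[OF M I(1)] by auto
  qed
  then show ?thesis
    unfolding bases_def by auto
qed

lemma finite_bases: "matroid M \<Longrightarrow> finite (bases M)"
  by (rule finite_subset[of _ "indep M"]) (auto simp: bases_def finite_indep)

text \<open>The bound \<open>K \<subseteq> I \<union> B\<close> is the point: if \<open>I\<close>
  consists of one new element and part of \<open>B\<close>, then \<open>K\<close> arises from
  \<open>B\<close> by a single exchange.\<close>

lemma indep_extends_to_basis:
  assumes M: "matroid M" and I: "I \<in> indep M" and B: "B \<in> bases M"
  shows "\<exists>K\<in>bases M. I \<subseteq> K \<and> K \<subseteq> I \<union> B"
proof -
  have B': "B \<in> indep M" "\<forall>I\<in>indep M. card I \<le> card B"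
    using B by (auto simp: bases_iff[OF M])
  then have "card I \<le> card B" using I by blast
  then obtain K where K: "K \<in> indep M" "I \<subseteq> K" "K \<subseteq> I \<union> B" "card K = card B"
    using indep_augment[OF M B'(1) I] by auto
  then have "K \<in> bases M" using B'(2) by (simp add: bases_iff[OF M])
  with K show ?thesis by blast
qed

lemma bases_nonempty: "matroid M \<Longrightarrow> bases M \<noteq> {}"
proof -
  assume M: "matroid M"
  let ?C = "card ` indep M"
  have "finite ?C" "?C \<noteq> {}"
    using finite_indep[OF M] matroidD(3)[OF M] by auto
  then obtain B where "B \<in> indep M" "Max ?C = card B"
    by (rule imageE[OF Max_in])
  moreover have "card I \<le> Max ?C" if "I \<in> indep M" for I
    by (rule Max_ge[OF \<open>finite ?C\<close>]) (use that in auto)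
  ultimately have "B \<in> indep M \<and> (\<forall>I\<in>indep M. card I \<le> card B)"
    by simp
  then have "B \<in> bases M" by (simp add: bases_iff[OF M])
  then show ?thesis by auto
qed

text \<open>
  Equivalent to \<open>B\<close> being the unique basis of minimal \<open>w\<close>-weight, but, unlike the weights, visibly
  dependent on the order of the values of \<open>w\<close> only. This makes genericity comparable for \<open>p\<close> and
  for its restrictions, whose parts are renumbered.
\<close>

definition greedy_basis :: "'a indep_system \<Rightarrow> ('a \<Rightarrow> nat) \<Rightarrow> 'a set \<Rightarrow> bool"
  where "greedy_basis M w B \<longleftrightarrow>
    B \<in> bases M \<and> (\<forall>y\<in>ground M - B. insert y {b \<in> B. w b < w y} \<notin> indep M)"

section \<open>Greedy bases and unique minimizers\<close>

lemma greedy_basis_cong_order: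
  assumes "matroid M" "\<And>a b. a \<in> ground M \<Longrightarrow> b \<in> ground M \<Longrightarrow> w a < w b \<longleftrightarrow> w' a < w' b"
  shows "greedy_basis M w B \<longleftrightarrow> greedy_basis M w' B"
proof -
  have "{b \<in> B. w b < w y} = {b \<in> B. w' b < w' y}" if "B \<in> bases M" "y \<in> ground M" for y
    using assms(2) that indep_finite(2)[OF assms(1), of B] by (auto simp: bases_def)
  then show ?thesis by (simp add: greedy_basis_def cong: conj_cong)
qed

text \<open>If \<open>B'\<close> differs from \<open>B\<close>, pick \<open>y\<close> in
  \<open>B'\<close> outside \<open>B\<close>. The lighter elements \<open>C\<close> of
  \<open>B\<close> span \<open>y\<close>, so one of them can replace \<open>y\<close> in
  \<open>B'\<close>. This lowers the weight and contradicts minimality of \<open>B'\<close>.\<close>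

lemma greedy_basis_unique_min:
  assumes M: "matroid M" and B: "greedy_basis M w B"
    and B': "is_arg_min (\<lambda>B. \<Sum>u\<in>B. w u) (\<lambda>B. B \<in> bases M) B'"
  shows "B' = B"
proof (rule ccontr)
  assume neq: "B' \<noteq> B"
  have BB: "B \<in> bases M" and BB': "B' \<in> bases M"
    using B B' by (auto simp: greedy_basis_def is_arg_min_def)
  have Bi: "B \<in> indep M" "B' \<in> indep M" and maxB: "\<And>I. I \<in> indep M \<Longrightarrow> card I \<le> card B'"
    using BB BB' by (auto simp: bases_iff[OF M])
  have fin: "finite B" "finite B'"
    using Bi indep_finite[OF M] by auto
  have "\<not> B' \<subseteq> B"
    using BB' Bi(1) neq by (auto simp: bases_def)
  then obtain y where y: "y \<in> B'" "y \<notin> B" by auto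
  define C where "C = {b \<in> B. w b < w y}"
  have yg: "y \<in> ground M" using y Bi indep_finite(2)[OF M] by blast
  have dep: "insert y C \<notin> indep M"
    using B y yg by (auto simp: greedy_basis_def C_def)
  have Ci: "C \<in> indep M" by (rule matroidD(4)[OF M Bi(1)]) (auto simp: C_def)
  have Di: "B' - {y} \<in> indep M" by (rule matroidD(4)[OF M Bi(2)]) auto
  have cardD: "Suc (card (B' - {y})) = card B'"
    by (rule card_Suc_Diff1) (use y fin in auto)
  \<comment> \<open>Otherwise \<open>B' - {y}\<close> would span \<open>C\<close> and therefore
    \<open>y\<close>, against independence of \<open>B'\<close>. The argument uses exchange in place
    of closures. Enlarge \<open>C\<close> inside \<open>C \<union> (B' - {y})\<close> to a set
    \<open>D\<close> of size \<open>card B' - 1\<close>, and add some \<open>z\<close> of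
    \<open>B'\<close>. Here \<open>z = y\<close> is excluded because \<open>C\<close> spans
    \<open>y\<close>. The enlarged set then offers \<open>B' - {y}\<close> a new element; it is not
    \<open>z\<close>, which already belongs to \<open>B' - {y}\<close>, so it comes from
    \<open>C\<close>.\<close>
  have "\<exists>x\<in>C. x \<notin> B' - {y} \<and> insert x (B' - {y}) \<in> indep M"
  proof (rule ccontr)
    assume no: "\<not> ?thesis"
    have cl: "card C \<le> card (B' - {y})"
    proof (rule ccontr)
      assume "\<not> card C \<le> card (B' - {y})"
      then show False using matroidD(5)[OF M Di Ci] no by auto
    qed
    then obtain D where D: "D \<in> indep M" "C \<subseteq> D" "D \<subseteq> C \<union> (B' - {y})" "card D = card (B' - {y})"
      using indep_augment[OF M Di Ci cl] by blast
    then obtain z where z: "z \<in> B' - D" "insert z D \<in> indep M"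
      using matroidD(5)[OF M D(1) Bi(2)] cardD by auto
    have "z \<noteq> y"
    proof
      assume "z = y"
      then have "insert y C \<in> indep M"
        using matroidD(4)[OF M z(2), of "insert y C"] D(2) by auto
      then show False using dep by simp
    qed
    have "finite D" using D(1) indep_finite[OF M] by blast
    then have "card (B' - {y}) < card (insert z D)"
      using z(1) D(4) by simp
    then obtain x where x: "x \<in> insert z D - (B' - {y})" "insert x (B' - {y}) \<in> indep M"
      using matroidD(5)[OF M Di z(2)] by auto
    then have "x \<in> C" using \<open>z \<noteq> y\<close> z(1) D(3) by auto
    then show False using no x by auto
  qed
  then obtain x where x: "x \<in> C" "x \<notin> B' - {y}" "insert x (B' - {y}) \<in> indep M" by blast
  define E where "E = insert x (B' - {y})"
  have "card E = card B'" using x(2) cardD fin by (simp add: E_def)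
  then have "E \<in> bases M"
    using x(3) maxB by (simp add: E_def bases_iff[OF M])
  then have "(\<Sum>u\<in>B'. w u) \<le> (\<Sum>u\<in>E. w u)"
    using B' by (auto simp: is_arg_min_def not_less)
  moreover have "(\<Sum>u\<in>E. w u) = w x + (\<Sum>u\<in>B' - {y}. w u)"
    using x(2) fin by (simp add: E_def)
  moreover have "(\<Sum>u\<in>B'. w u) = w y + (\<Sum>u\<in>B' - {y}. w u)"
    using y fin by (simp add: sum.remove)
  moreover have "w x < w y" using x(1) by (simp add: C_def)
  ultimately show False by simp
qed

text \<open>If \<open>y\<close> is independent of the lighter elements of \<open>B\<close>, extend
  these together with \<open>y\<close> to a basis \<open>K\<close> inside \<open>insert y B\<close>.
  It drops one element of \<open>B\<close> that is not lighter than \<open>y\<close>, so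
  \<open>K\<close> is a second minimizer.\<close>

lemma unique_min_greedy_basis:
  assumes M: "matroid M"
    and B: "is_arg_min (\<lambda>B. \<Sum>u\<in>B. w u) (\<lambda>B. B \<in> bases M) B"
    and uniq: "\<And>B'. is_arg_min (\<lambda>B. \<Sum>u\<in>B. w u) (\<lambda>B. B \<in> bases M) B' \<Longrightarrow> B' = B"
  shows "greedy_basis M w B"
proof -
  have BB: "B \<in> bases M" and min: "\<And>B'. B' \<in> bases M \<Longrightarrow> (\<Sum>u\<in>B. w u) \<le> (\<Sum>u\<in>B'. w u)"
    using B by (auto simp: is_arg_min_def not_less)
  have Bi: "B \<in> indep M" using BB by (simp add: bases_def)
  have fin: "finite B" using Bi indep_finite[OF M] by auto
  have "insert y {b \<in> B. w b < w y} \<notin> indep M" if y: "y \<in> ground M - B" for y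
  proof
    assume "insert y {b \<in> B. w b < w y} \<in> indep M"
    then obtain K where K: "K \<in> bases M" "insert y {b \<in> B. w b < w y} \<subseteq> K"
        "K \<subseteq> insert y {b \<in> B. w b < w y} \<union> B"
      using indep_extends_to_basis[OF M _ BB] by blast
    have "card K = card B"
      using K(1) BB by (auto simp: bases_iff[OF M] intro: antisym)
    moreover have KB: "K = insert y (K - {y})" "K - {y} \<subseteq> B" "y \<in> K"
      using K by auto
    moreover have "finite K" using KB fin finite_subset by fastforce
    ultimately have cK: "Suc (card (K - {y})) = card B"
      by (metis card_Suc_Diff1)
    then have "card (B - (K - {y})) = 1"
      using card_Diff_subset[of "K - {y}" B] KB(2) fin finite_subset[OF KB(2) fin] by auto
    then obtain x where x: "B - (K - {y}) = {x}"
      by (auto simp: card_1_singleton_iff)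
    \<comment> \<open>\<open>x\<close> is the element of \<open>B\<close> displaced by
      \<open>y\<close>; every element of \<open>B\<close> lighter than \<open>y\<close> was kept in
      \<open>K\<close>.\<close>
    have "w y \<le> w x"
    proof (rule ccontr)
      assume "\<not> w y \<le> w x"
      then have "x \<in> K" using K(2) x by auto
      then show False using x y by auto
    qed
    moreover have "(\<Sum>u\<in>B. w u) = w x + (\<Sum>u\<in>K - {y}. w u)"
    proof -
      have "B = insert x (K - {y})" "x \<notin> K - {y}" using x KB(2) by auto
      then show ?thesis using fin by (metis finite_insert sum.insert)
    qed
    moreover have "(\<Sum>u\<in>K. w u) = w y + (\<Sum>u\<in>K - {y}. w u)"
      using KB(3) \<open>finite K\<close> by (simp add: sum.remove)
    ultimately have "is_arg_min (\<lambda>B. \<Sum>u\<in>B. w u) (\<lambda>B. B \<in> bases M) K"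
      using min K(1) by (fastforce simp: is_arg_min_def not_less)
    then have "K = B" by (rule uniq)
    then show False using KB(3) y by auto
  qed
  then show ?thesis using BB by (simp add: greedy_basis_def)
qed

lemma generic_iff_greedy_basis:
  assumes M: "matroid M"
  shows "generic M p \<longleftrightarrow> (\<exists>B. greedy_basis M (comp_index p) B)"
proof -
  let ?P = "is_arg_min (\<lambda>B. \<Sum>u\<in>B. comp_index p u) (\<lambda>B. B \<in> bases M)"
  show ?thesis
  proof
    assume "generic M p"
    then obtain B where B: "?P B" and uniq: "\<exists>\<^sub>\<le>\<^sub>1B. ?P B"
      unfolding generic_def by (elim alt_ex1E') (rule that)
    have "B' = B" if "?P B'" for B'
      by (rule Uniq_D[OF uniq that B])
    then have "greedy_basis M (comp_index p) B"
      by (rule unique_min_greedy_basis[OF M B])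
    then show "\<exists>B. greedy_basis M (comp_index p) B" ..
  next
    assume "\<exists>B. greedy_basis M (comp_index p) B"
    then obtain B where B: "greedy_basis M (comp_index p) B" ..
    obtain B' where B': "?P B'"
      using ex_is_arg_min_if_finite[OF finite_bases[OF M] bases_nonempty[OF M],
          of "\<lambda>B. \<Sum>u\<in>B. comp_index p u"] ..
    have eq: "B'' = B" if "?P B''" for B''
      by (rule greedy_basis_unique_min[OF M B that])
    have "\<exists>!B. ?P B"
    \<comment> \<open>A greedy basis is so far only known to be the sole candidate. The witness is
      the minimizer \<open>B'\<close> that exists by finiteness, and it then equals
      \<open>B\<close>.\<close>
    proof (rule ex1I)
      show "?P B'" by (rule B')
      show "B'' = B'" if "?P B''" for B''
        using eq[OF that] eq[OF B'] by simp
    qed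
    then show "generic M p" unfolding generic_def .
  qed
qed

section \<open>Direct sums of matroids\<close>

lemma ground_simps [simp]:
  "ground (direct_sum M N) = ground M \<union> ground N"
  "ground (restriction M A) = A"
  "ground (contraction M A) = ground M - A"
  by (simp_all add: direct_sum_def restriction_def contraction_def)

text \<open>As the ground sets are disjoint, the two pieces of \<open>I\<close> can only be its
  traces on them.\<close>

lemma indep_direct_sum:
  assumes "matroid M" "matroid N" "ground M \<inter> ground N = {}"
  shows "I \<in> indep (direct_sum M N) \<longleftrightarrow>
    I \<subseteq> ground M \<union> ground N \<and> I \<inter> ground M \<in> indep M \<and> I \<inter> ground N \<in> indep N"
proof
  assume "I \<in> indep (direct_sum M N)"
  then obtain J K where JK: "I = J \<union> K" "J \<in> indep M" "K \<in> indep N"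
    by (auto simp: direct_sum_def)
  moreover have JK': "J \<subseteq> ground M" "K \<subseteq> ground N"
    using indep_finite(2)[OF assms(1) JK(2)] indep_finite(2)[OF assms(2) JK(3)] .
  moreover have "I \<inter> ground M = J" "I \<inter> ground N = K"
    using JK(1) JK' assms(3) by auto
  ultimately show "I \<subseteq> ground M \<union> ground N \<and> I \<inter> ground M \<in> indep M \<and> I \<inter> ground N \<in> indep N"
    by auto
next
  assume I: "I \<subseteq> ground M \<union> ground N \<and> I \<inter> ground M \<in> indep M \<and> I \<inter> ground N \<in> indep N"
  then have "I = (I \<inter> ground M) \<union> (I \<inter> ground N)" by auto
  then show "I \<in> indep (direct_sum M N)"
    unfolding direct_sum_def indep_system.sel using I by blast
qed

lemma matroid_direct_sum:
  assumes M: "matroid M" and N: "matroid N" and disj: "ground M \<inter> ground N = {}"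
  shows "matroid (direct_sum M N)"
proof -
  note iff = indep_direct_sum[OF M N disj]
  have "\<exists>x\<in>J - I. insert x I \<in> indep (direct_sum M N)"
    if I: "I \<in> indep (direct_sum M N)" and J: "J \<in> indep (direct_sum M N)" and c: "card I < card J"
    for I J
  proof -
    have card: "card L = card (L \<inter> ground M) + card (L \<inter> ground N)"
      if "L \<in> indep (direct_sum M N)" for L
    proof -
      have "L = (L \<inter> ground M) \<union> (L \<inter> ground N)" using that by (auto simp: iff)
      moreover have "card \<dots> = card (L \<inter> ground M) + card (L \<inter> ground N)"
        by (rule card_Un_disjoint) (use matroidD(1)[OF M] matroidD(1)[OF N] disj in auto)
      ultimately show ?thesis by simp
    qed
    \<comment> \<open>The sizes of the two traces add up, so in at least one summand the trace of
      \<open>I\<close> is smaller and exchange can be done there.\<close>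
    consider "card (I \<inter> ground M) < card (J \<inter> ground M)"
      | "card (I \<inter> ground N) < card (J \<inter> ground N)"
      using c card[OF I] card[OF J] by linarith
    then show ?thesis
    proof cases
      case 1
      then obtain x where x: "x \<in> J \<inter> ground M - I \<inter> ground M" "insert x (I \<inter> ground M) \<in> indep M"
        using matroidD(5)[OF M, of "I \<inter> ground M" "J \<inter> ground M"] I J by (auto simp: iff)
      have "insert x I \<inter> ground M = insert x (I \<inter> ground M)" "insert x I \<inter> ground N = I \<inter> ground N"
        using x(1) disj by auto
      then show ?thesis using x I by (intro bexI[of _ x]) (auto simp: iff)
    next
      case 2
      then obtain x where x: "x \<in> J \<inter> ground N - I \<inter> ground N" "insert x (I \<inter> ground N) \<in> indep N"
        using matroidD(5)[OF N, of "I \<inter> ground N" "J \<inter> ground N"] I J by (auto simp: iff)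
      have "insert x I \<inter> ground N = insert x (I \<inter> ground N)" "insert x I \<inter> ground M = I \<inter> ground M"
        using x(1) disj by auto
      then show ?thesis using x I by (intro bexI[of _ x]) (auto simp: iff)
    qed
  qed
  moreover have "J \<in> indep (direct_sum M N)" if "I \<in> indep (direct_sum M N)" "J \<subseteq> I" for I J
    using that matroidD(4)[OF M, of "I \<inter> ground M" "J \<inter> ground M"]
      matroidD(4)[OF N, of "I \<inter> ground N" "J \<inter> ground N"] by (auto simp: iff)
  moreover have "{} \<in> indep (direct_sum M N)" "indep (direct_sum M N) \<subseteq> Pow (ground M \<union> ground N)"
    using matroidD(3)[OF M] matroidD(3)[OF N] by (auto simp: iff)
  ultimately show ?thesis
    using matroidD(1)[OF M] matroidD(1)[OF N] by (intro matroidI) simp_all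
qed

lemma insert_indep_direct_sum:
  assumes M: "matroid M" and N: "matroid N" and disj: "ground M \<inter> ground N = {}"
    and I: "I \<in> indep (direct_sum M N)"
  shows "y \<in> ground M \<Longrightarrow>
      insert y I \<in> indep (direct_sum M N) \<longleftrightarrow> insert y (I \<inter> ground M) \<in> indep M"
    and "y \<in> ground N \<Longrightarrow>
      insert y I \<in> indep (direct_sum M N) \<longleftrightarrow> insert y (I \<inter> ground N) \<in> indep N"
proof -
  note iff = indep_direct_sum[OF M N disj]
  assume y: "y \<in> ground M"
  then have "insert y I \<inter> ground M = insert y (I \<inter> ground M)" "insert y I \<inter> ground N = I \<inter> ground N"
    using disj by auto
  then show "insert y I \<in> indep (direct_sum M N) \<longleftrightarrow> insert y (I \<inter> ground M) \<in> indep M"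
    using I y by (simp add: iff)
next
  note iff = indep_direct_sum[OF M N disj]
  assume y: "y \<in> ground N"
  then have "insert y I \<inter> ground N = insert y (I \<inter> ground N)" "insert y I \<inter> ground M = I \<inter> ground M"
    using disj by auto
  then show "insert y I \<in> indep (direct_sum M N) \<longleftrightarrow> insert y (I \<inter> ground N) \<in> indep N"
    using I y by (simp add: iff)
qed

text \<open>Whether \<open>y\<close> can be added to an independent set is decided in the summand
  containing \<open>y\<close>. Both clauses of \<open>greedy_basis\<close> speak only of adding one
  element, so both split.\<close>

lemma greedy_basis_direct_sum:
  assumes M: "matroid M" and N: "matroid N" and disj: "ground M \<inter> ground N = {}"
    and B: "B \<subseteq> ground M \<union> ground N"
  shows "greedy_basis (direct_sum M N) w B \<longleftrightarrow>
    greedy_basis M w (B \<inter> ground M) \<and> greedy_basis N w (B \<inter> ground N)"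
proof -
  let ?S = "direct_sum M N"
  note S = matroid_direct_sum[OF M N disj] and iff = indep_direct_sum[OF M N disj]
  note ins = insert_indep_direct_sum[OF M N disj]
  have bas: "B \<in> bases ?S \<longleftrightarrow> B \<inter> ground M \<in> bases M \<and> B \<inter> ground N \<in> bases N"
  proof (cases "B \<in> indep ?S")
    case True
    then have i: "B \<inter> ground M \<in> indep M" "B \<inter> ground N \<in> indep N" by (auto simp: iff)
    show ?thesis
      unfolding bases_iff_insert[OF S] bases_iff_insert[OF M] bases_iff_insert[OF N]
      using True i ins[OF True] disj by (auto simp: Ball_def)
  next
    case False
    then show ?thesis using iff[of B] B by (auto simp: bases_def)
  qed
  show ?thesis
  proof (cases "B \<in> bases ?S")
    case True
    have L: "{b \<in> B. w b < w y} \<in> indep ?S" for y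
      by (rule matroidD(4)[OF S, of B]) (use True in \<open>auto simp: bases_def\<close>)
    have e: "{b \<in> B. w b < w y} \<inter> U = {b \<in> B \<inter> U. w b < w y}" for y U by auto
    have "(\<forall>y\<in>ground ?S - B. insert y {b \<in> B. w b < w y} \<notin> indep ?S) \<longleftrightarrow>
      (\<forall>y\<in>ground M - B. insert y {b \<in> B \<inter> ground M. w b < w y} \<notin> indep M) \<and>
      (\<forall>y\<in>ground N - B. insert y {b \<in> B \<inter> ground N. w b < w y} \<notin> indep N)"
      using ins[OF L] unfolding e by (auto simp: Ball_def)
    moreover have "ground M - B = ground M - B \<inter> ground M" "ground N - B = ground N - B \<inter> ground N"
      by auto
    ultimately show ?thesis using True bas by (simp add: greedy_basis_def)
  next
    case False
    then show ?thesis using bas by (auto simp: greedy_basis_def)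
  qed
qed

section \<open>Restrictions and contractions\<close>

lemma matroid_restriction:
  assumes M: "matroid M" and A: "A \<subseteq> ground M"
  shows "matroid (restriction M A)"
proof -
  have ax: "\<exists>x\<in>J - I. insert x I \<in> indep (restriction M A)"
    if "I \<in> indep (restriction M A)" "J \<in> indep (restriction M A)" "card I < card J" for I J
    using that matroidD(5)[OF M, of I J] by (auto simp: restriction_def)
  have "finite A" using matroidD(1)[OF M] A finite_subset by blast
  moreover have "J \<in> indep (restriction M A)" if "I \<in> indep (restriction M A)" "J \<subseteq> I" for I J
    using that matroidD(4)[OF M] by (auto simp: restriction_def)
  moreover have "{} \<in> indep (restriction M A)" "indep (restriction M A) \<subseteq> Pow A"
    using matroidD(3)[OF M] by (auto simp: restriction_def)
  ultimately show ?thesis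
    using ax by (intro matroidI) simp_all
qed

lemma indep_restriction: "I \<in> indep (restriction M A) \<longleftrightarrow> I \<in> indep M \<and> I \<subseteq> A"
  by (auto simp: restriction_def)

text \<open>The definition allows any basis of the restriction as a witness; this replaces it by a
  prescribed \<open>J\<close>, so that \<open>B \<inter> A\<close> can be used later.\<close>

lemma indep_contraction:
  assumes M: "matroid M" and A: "A \<subseteq> ground M" and J: "J \<in> bases (restriction M A)"
  shows "I \<in> indep (contraction M A) \<longleftrightarrow> I \<subseteq> ground M - A \<and> I \<union> J \<in> indep M"
proof
  assume "I \<in> indep (contraction M A)"
  then obtain J' where I: "I \<subseteq> ground M - A" and J': "J' \<in> bases (restriction M A)" "I \<union> J' \<in> indep M"
    by (auto simp: contraction_def)
  note R = matroid_restriction[OF M A]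
  have JA: "J \<subseteq> A" "J' \<subseteq> A" and Ji: "J \<in> indep M" "J' \<in> indep M"
    and max: "\<And>L. L \<in> indep M \<Longrightarrow> L \<subseteq> A \<Longrightarrow> card L \<le> card J"
    using J J' by (auto simp: indep_restriction bases_iff[OF R])
  have fin: "finite I" "finite J" "finite J'"
    using indep_finite[OF M] J'(2) Ji by auto
  have "card J' \<le> card J" "card J \<le> card J'"
    using J J'(1) by (auto simp: bases_iff[OF R])
  then have cJ: "card J = card J'" by simp
  have cIJ: "card (I \<union> J') = card I + card J"
    using I JA fin cJ by (subst card_Un_disjoint) auto
  \<comment> \<open>Enlarge \<open>J\<close> by elements of \<open>I \<union> J'\<close>. Inside
    \<open>A\<close> nothing can be added to the basis \<open>J\<close>, so all
    \<open>card I\<close> new elements come from \<open>I\<close>, and \<open>K\<close> is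
    \<open>I \<union> J\<close>.\<close>
  then obtain K where K: "K \<in> indep M" "J \<subseteq> K" "K \<subseteq> J \<union> (I \<union> J')" "card K = card I + card J"
    using indep_augment[OF M J'(2) Ji(1)] by auto
  have KA: "K \<inter> A \<in> indep M" by (rule matroidD(4)[OF M K(1)]) auto
  have "finite K" using indep_finite[OF M K(1)] by simp
  have "J = K \<inter> A"
    by (rule card_seteq) (use K(2) JA max[OF KA] \<open>finite K\<close> in auto)
  moreover have "K = (K \<inter> A) \<union> (K - A)" by auto
  ultimately have "card K = card J + card (K - A)"
    using \<open>finite K\<close> by (metis Int_Diff_disjoint card_Un_disjoint finite_Diff finite_Int)
  then have "card (K - A) = card I" using K(4) by simp
  moreover have "K - A \<subseteq> I" using K(3) JA by auto
  ultimately have "K - A = I" using fin(1) by (simp add: card_subset_eq)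
  then have "I \<union> J = K" using \<open>J = K \<inter> A\<close> by auto
  then show "I \<subseteq> ground M - A \<and> I \<union> J \<in> indep M" using I K(1) by simp
next
  assume "I \<subseteq> ground M - A \<and> I \<union> J \<in> indep M"
  with J show "I \<in> indep (contraction M A)" by (auto simp: contraction_def)
qed

text \<open>Adding a fixed basis \<open>J\<close> of the restriction raises all sizes by
  \<open>card J\<close>, so exchange can be done in \<open>M\<close>. The element found lies outside
  \<open>J\<close>, hence in \<open>L - I\<close>.\<close>

lemma matroid_contraction:
  assumes M: "matroid M" and A: "A \<subseteq> ground M"
  shows "matroid (contraction M A)"
proof -
  obtain J where J: "J \<in> bases (restriction M A)"
    using bases_nonempty[OF matroid_restriction[OF M A]] by auto
  note iff = indep_contraction[OF M A J]
  have JA: "J \<subseteq> A" "J \<in> indep M" using J by (auto simp: bases_def indep_restriction)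
  have ax: "\<exists>x\<in>L - I. insert x I \<in> indep (contraction M A)"
    if I: "I \<in> indep (contraction M A)" and L: "L \<in> indep (contraction M A)" and c: "card I < card L"
    for I L
  proof -
    have card: "card (X \<union> J) = card X + card J" if "X \<in> indep (contraction M A)" for X
      using that indep_finite(1)[OF M, of "X \<union> J"] JA
      by (intro card_Un_disjoint) (auto simp: iff)
    have "card (I \<union> J) < card (L \<union> J)" using c by (simp add: card I L)
    then obtain x where "x \<in> (L \<union> J) - (I \<union> J)" "insert x (I \<union> J) \<in> indep M"
      using matroidD(5)[OF M, of "I \<union> J" "L \<union> J"] I L by (auto simp: iff)
    then show ?thesis using I L by (intro bexI[of _ x]) (auto simp: iff)
  qed
  have "X \<in> indep (contraction M A)" if "I \<in> indep (contraction M A)" "X \<subseteq> I" for I X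
    using that matroidD(4)[OF M, of "I \<union> J" "X \<union> J"] by (auto simp: iff)
  moreover have "{} \<in> indep (contraction M A)" "indep (contraction M A) \<subseteq> Pow (ground M - A)"
    using JA by (auto simp: iff)
  ultimately show ?thesis
    using ax matroidD(1)[OF M] by (intro matroidI) simp_all
qed

text \<open>For \<open>y\<close> in \<open>A\<close>, all lighter elements lie in \<open>A\<close>,
  so the test takes place in the restriction. For \<open>y\<close> outside \<open>A\<close>, the
  lighter elements of \<open>B\<close> include all of \<open>B \<inter> A\<close>. Once this is a
  basis of the restriction, \<open>indep_contraction\<close> turns the test in \<open>M\<close> into
  the test in the contraction.\<close>

lemma greedy_basis_restriction_contraction:
  assumes M: "matroid M" and A: "A \<subseteq> ground M" and B: "B \<subseteq> ground M"
    and less: "\<And>a b. a \<in> A \<Longrightarrow> b \<in> ground M - A \<Longrightarrow> w a < w b"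
  shows "greedy_basis M w B \<longleftrightarrow>
    greedy_basis (restriction M A) w (B \<inter> A) \<and> greedy_basis (contraction M A) w (B - A)"
proof -
  note R = matroid_restriction[OF M A] and C = matroid_contraction[OF M A]
  have low: "{b \<in> B. w b < w y} = {b \<in> B \<inter> A. w b < w y}" if "y \<in> A" for y
    using that B less by (force dest: less_asym)
  have high: "{b \<in> B. w b < w y} = {b \<in> B - A. w b < w y} \<union> (B \<inter> A)" if "y \<in> ground M - A" for y
    using that less by auto
  have *: "(\<forall>y\<in>A - B. insert y {b \<in> B. w b < w y} \<notin> indep M) \<longleftrightarrow>
      (\<forall>y\<in>A - B \<inter> A. insert y {b \<in> B \<inter> A. w b < w y} \<notin> indep (restriction M A))"
    using low by (auto simp: indep_restriction)
  have **: "(\<forall>y\<in>ground M - A - B. insert y {b \<in> B. w b < w y} \<notin> indep M) \<longleftrightarrow>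
      (\<forall>y\<in>ground M - A - (B - A). insert y {b \<in> B - A. w b < w y} \<notin> indep (contraction M A))"
    if "B \<inter> A \<in> bases (restriction M A)"
  proof -
    have "insert y {b \<in> B. w b < w y} \<in> indep M \<longleftrightarrow>
        insert y {b \<in> B - A. w b < w y} \<in> indep (contraction M A)" if "y \<in> ground M - A - B" for y
      using high[of y] that B
      by (subst indep_contraction[OF M A \<open>B \<inter> A \<in> bases (restriction M A)\<close>]) auto
    then show ?thesis by auto
  qed
  have split: "(\<forall>y\<in>ground M - B. P y) \<longleftrightarrow> (\<forall>y\<in>A - B. P y) \<and> (\<forall>y\<in>ground M - A - B. P y)" for P
    using A by auto
  have bas: "B \<in> bases M \<longleftrightarrow> B - A \<in> bases (contraction M A)"
    if BA: "B \<inter> A \<in> bases (restriction M A)"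
  proof -
    note iff = indep_contraction[OF M A BA]
    have u: "B - A \<union> B \<inter> A = B" by auto
    have i: "B - A \<in> indep (contraction M A) \<longleftrightarrow> B \<in> indep M"
      using iff[of "B - A"] B u by auto
    have i2: "insert y (B - A) \<in> indep (contraction M A) \<longleftrightarrow> insert y B \<in> indep M"
      if "y \<in> ground M - A - B" for y
      using iff[of "insert y (B - A)"] B u that by (auto simp: Un_commute)
    \<comment> \<open>Elements of \<open>A\<close> are already blocked by the basis
      \<open>B \<inter> A\<close>, so maximality of \<open>B\<close> only has to be tested outside
      \<open>A\<close>.\<close>
    have i3: "insert y B \<notin> indep M" if "y \<in> A - B" for y
    proof
      assume "insert y B \<in> indep M"
      then have "insert y (B \<inter> A) \<in> indep (restriction M A)"
        using that matroidD(4)[OF M, of "insert y B" "insert y (B \<inter> A)"]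
        by (auto simp: indep_restriction)
      then show False using BA that by (auto simp: bases_iff_insert[OF R])
    qed
    show ?thesis
      unfolding bases_iff_insert[OF M] bases_iff_insert[OF C] split
      using i i2 i3 by auto
  qed
  show ?thesis
  proof (cases "B \<inter> A \<in> bases (restriction M A)")
    case True
    then show ?thesis
      using bas[OF True] **[OF True] * unfolding greedy_basis_def split by (simp add: conj_ac)
  next
    case False
    \<comment> \<open>A greedy \<open>B\<close> must trace a basis on \<open>A\<close>: otherwise
      some \<open>y\<close> in \<open>A\<close> could be added to \<open>B \<inter> A\<close>, and a
      fortiori to the lighter elements of \<open>B\<close>.\<close>
    have "\<not> greedy_basis M w B"
    proof
      assume g: "greedy_basis M w B"
      have "B \<inter> A \<in> indep (restriction M A)"
        using g matroidD(4)[OF M, of B "B \<inter> A"]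
        by (auto simp: greedy_basis_def bases_def indep_restriction)
      with False obtain y where y: "y \<in> A - B" "insert y (B \<inter> A) \<in> indep M"
        by (auto simp: bases_iff_insert[OF R] indep_restriction)
      then have "insert y {b \<in> B. w b < w y} \<in> indep M"
        using low[of y] by (intro matroidD(4)[OF M y(2)]) auto
      then show False using g y(1) A by (auto simp: greedy_basis_def)
    qed
    then show ?thesis using False by (auto simp: greedy_basis_def)
  qed
qed


section \<open>Relabelled matroids\<close>

lemma matroid_image:
  assumes M: "matroid M" and inj: "inj_on \<sigma> (ground M)"
  shows "matroid (matroid_image \<sigma> M)"
proof (rule matroidI)
  let ?M = "matroid_image \<sigma> M"
  have img: "indep ?M = (`) \<sigma> ` indep M" "ground ?M = \<sigma> ` ground M"
    by (simp_all add: matroid_image_def)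
  show "finite (ground ?M)" "indep ?M \<subseteq> Pow (ground ?M)" "{} \<in> indep ?M"
    using matroidD(1-3)[OF M] unfolding img by auto
  show "J' \<in> indep ?M" if *: "I' \<in> indep ?M" "J' \<subseteq> I'" for I' J'
  proof -
    obtain I where I: "I \<in> indep M" "I' = \<sigma> ` I" using *(1) unfolding img by auto
    obtain J where "J \<subseteq> I" "J' = \<sigma> ` J" using *(2) I(2) by (meson subset_image_iff)
    then show ?thesis using matroidD(4)[OF M I(1)] unfolding img by blast
  qed
  show "\<exists>x\<in>J' - I'. insert x I' \<in> indep ?M"
    if *: "I' \<in> indep ?M" "J' \<in> indep ?M" "card I' < card J'" for I' J'
  proof -
    obtain I J where I: "I \<in> indep M" "I' = \<sigma> ` I" and J: "J \<in> indep M" "J' = \<sigma> ` J"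
      using *(1,2) unfolding img by auto
    have sub: "I \<subseteq> ground M" "J \<subseteq> ground M"
      using indep_finite(2)[OF M I(1)] indep_finite(2)[OF M J(1)] .
    then have "card I < card J"
      using *(3) unfolding I(2) J(2) by (simp add: card_image[OF inj_on_subset[OF inj]])
    then obtain x where x: "x \<in> J - I" "insert x I \<in> indep M"
      using matroidD(5)[OF M I(1) J(1)] by blast
    then have "\<sigma> x \<in> J' - I'"
      using sub I(2) J(2) by (auto dest: inj_onD[OF inj])
    moreover have "insert (\<sigma> x) I' \<in> indep ?M"
      unfolding img I(2) using x(2) by (metis image_eqI image_insert)
    ultimately show ?thesis by blast
  qed
qed

lemma bases_matroid_image:
  assumes M: "matroid M" and inj: "inj_on \<sigma> (ground M)"
  shows "bases (matroid_image \<sigma> M) = (`) \<sigma> ` bases M"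
proof -
  have img: "indep (matroid_image \<sigma> M) = (`) \<sigma> ` indep M"
    by (simp add: matroid_image_def)
  have sub: "I \<subseteq> J" if "I \<in> indep M" "J \<in> indep M" "\<sigma> ` I \<subseteq> \<sigma> ` J" for I J
  proof
    fix x assume "x \<in> I"
    then obtain y where "y \<in> J" "\<sigma> x = \<sigma> y" using \<open>\<sigma> ` I \<subseteq> \<sigma> ` J\<close> by auto
    moreover have "x \<in> ground M" "y \<in> ground M"
      using \<open>x \<in> I\<close> \<open>y \<in> J\<close> indep_finite(2)[OF M] \<open>I \<in> indep M\<close> \<open>J \<in> indep M\<close> by blast+
    ultimately show "x \<in> J" using inj by (metis inj_onD)
  qed
  have eq: "\<sigma> ` I = \<sigma> ` J \<longleftrightarrow> I = J" if "I \<in> indep M" "J \<in> indep M" for I J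
    using sub[OF that] sub[OF that(2,1)] by blast
  have "\<sigma> ` I \<subseteq> \<sigma> ` J \<longleftrightarrow> I \<subseteq> J" if "I \<in> indep M" "J \<in> indep M" for I J
    using sub[OF that] by blast
  with eq have iff: "\<sigma> ` B \<in> bases (matroid_image \<sigma> M) \<longleftrightarrow> B \<in> bases M" if "B \<in> indep M" for B
    using that by (simp add: bases_def img)
  show ?thesis
  proof (intro equalityI subsetI)
    fix X assume X: "X \<in> bases (matroid_image \<sigma> M)"
    then have "X \<in> (`) \<sigma> ` indep M"
      unfolding bases_def img by simp
    then obtain B where "B \<in> indep M" "X = \<sigma> ` B" by auto
    with X iff show "X \<in> (`) \<sigma> ` bases M" by blast
  next
    fix X assume "X \<in> (`) \<sigma> ` bases M"
    then obtain B where B: "B \<in> bases M" "X = \<sigma> ` B" by auto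
    then have "B \<in> indep M" by (simp add: bases_def)
    with B iff show "X \<in> bases (matroid_image \<sigma> M)" by blast
  qed
qed

lemma ex1_is_arg_min_reindex:
  assumes inj: "inj_on h S" and f: "\<And>x. x \<in> S \<Longrightarrow> f' (h x) = f x"
  shows "(\<exists>!y. is_arg_min f' (\<lambda>y. y \<in> h ` S) y) \<longleftrightarrow> (\<exists>!x. is_arg_min f (\<lambda>x. x \<in> S) x)"
    (is "(\<exists>!y. ?P' y) \<longleftrightarrow> (\<exists>!x. ?P x)")
proof -
  have iff: "?P' (h x) \<longleftrightarrow> ?P x" if "x \<in> S" for x
    using that f by (auto simp: is_arg_min_def)
  have P': "\<exists>x\<in>S. y = h x" if "?P' y" for y
    using that by (auto simp: is_arg_min_def)
  have P: "x \<in> S" if "?P x" for x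
    using that by (auto simp: is_arg_min_def)
  show ?thesis
  proof
    assume "\<exists>!y. ?P' y"
    then obtain y where y: "?P' y" and uniq: "\<exists>\<^sub>\<le>\<^sub>1y. ?P' y" by (elim alt_ex1E') (rule that)
    obtain x where x: "x \<in> S" "y = h x" using P'[OF y] by blast
    show "\<exists>!x. ?P x"
    proof (rule ex1I)
      show "?P x" using iff[OF x(1)] y x(2) by simp
      show "x' = x" if "?P x'" for x'
      proof -
        have "h x' = h x" using Uniq_D[OF uniq] y iff[OF P[OF that]] that x(2) by simp
        then show ?thesis using inj P[OF that] x(1) by (simp add: inj_on_eq_iff)
      qed
    qed
  next
    assume "\<exists>!x. ?P x"
    then obtain x where x: "?P x" and uniq: "\<exists>\<^sub>\<le>\<^sub>1x. ?P x" by (elim alt_ex1E') (rule that)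
    show "\<exists>!y. ?P' y"
    proof (rule ex1I)
      show "?P' (h x)" using iff[OF P[OF x]] x by simp
      show "y = h x" if y: "?P' y" for y
      proof -
        obtain x' where x': "x' \<in> S" "y = h x'" using P'[OF y] by blast
        then have "?P x'" using iff y by simp
        then show ?thesis using Uniq_D[OF uniq _ x] x'(2) by blast
      qed
    qed
  qed
qed


section \<open>Set compositions\<close>

lemma set_compositions_Nil [simp]: "[] \<in> set_compositions U \<longleftrightarrow> U = {}"
  by (auto simp: set_compositions_def partition_on_def)

lemma set_compositionsD:
  assumes "p \<in> set_compositions U"
  shows "\<Union> (set p) = U" "{} \<notin> set p" "distinct p"
    and "\<And>X Y. X \<in> set p \<Longrightarrow> Y \<in> set p \<Longrightarrow> X \<noteq> Y \<Longrightarrow> X \<inter> Y = {}"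
  using assms by (auto simp: set_compositions_def partition_on_def dest: disjointD)

lemma set_compositionsI:
  assumes "\<Union> (set p) = U" "{} \<notin> set p" "distinct p"
    and "\<And>X Y. X \<in> set p \<Longrightarrow> Y \<in> set p \<Longrightarrow> X \<noteq> Y \<Longrightarrow> X \<inter> Y = {}"
  shows "p \<in> set_compositions U"
  using assms unfolding set_compositions_def partition_on_def
  by (intro CollectI conjI disjointI)

text \<open>The recursion behind the inductions over compositions. The ground set shrinks with the
  list, which is why those inductions generalize over it.\<close>

lemma set_compositions_Cons:
  "X # p \<in> set_compositions U \<longleftrightarrow> X \<noteq> {} \<and> X \<subseteq> U \<and> p \<in> set_compositions (U - X)"
proof
  assume "X # p \<in> set_compositions U"
  note p = set_compositionsD[OF this]
  have disj: "X \<inter> Y = {}" if "Y \<in> set p" for Y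
    by (rule p(4)) (use p(3) that in auto)
  have "p \<in> set_compositions (U - X)"
  proof (rule set_compositionsI)
    show "\<Union> (set p) = U - X"
      using p(1) disj by fastforce
    show "Y \<inter> Z = {}" if "Y \<in> set p" "Z \<in> set p" "Y \<noteq> Z" for Y Z
      by (rule p(4)) (use that in auto)
  qed (use p(2,3) in auto)
  then show "X \<noteq> {} \<and> X \<subseteq> U \<and> p \<in> set_compositions (U - X)"
    using p(1,2) by auto
next
  assume *: "X \<noteq> {} \<and> X \<subseteq> U \<and> p \<in> set_compositions (U - X)"
  then have "p \<in> set_compositions (U - X)" by simp
  note p = set_compositionsD[OF this]
  have disj: "X \<inter> Y = {}" "Y \<inter> X = {}" if "Y \<in> set p" for Y
    using p(1) that by auto
  show "X # p \<in> set_compositions U"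
  proof (rule set_compositionsI)
    show "\<Union> (set (X # p)) = U"
      using * p(1) by auto
    have "X \<notin> set p" using * disj by blast
    then show "distinct (X # p)" using p(3) by simp
    show "Y \<inter> Z = {}" if "Y \<in> set (X # p)" "Z \<in> set (X # p)" "Y \<noteq> Z" for Y Z
      using that disj p(4)[of Y Z] by auto
  qed (use * p(2) in auto)
qed

section \<open>Positions of elements in a composition\<close>

lemma comp_index_eq:
  assumes p: "p \<in> set_compositions U" and i: "i < length p" "u \<in> p ! i"
  shows "comp_index p u = Suc i"
proof -
  have "j = i" if j: "j < length p" "u \<in> p ! j" for j
  proof (rule ccontr)
    assume "j \<noteq> i"
    \<comment> \<open>Different positions of a distinct list carry different, hence disjoint,
      parts.\<close>
    then have "p ! j \<noteq> p ! i"
      using set_compositionsD(3)[OF p] i(1) j(1) by (simp add: nth_eq_iff_index_eq)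
    then have "p ! j \<inter> p ! i = {}"
      by (rule set_compositionsD(4)[OF p nth_mem[OF j(1)] nth_mem[OF i(1)]])
    then show False using i(2) j(2) by auto
  qed
  then have "(THE i. i < length p \<and> u \<in> p ! i) = i"
    using i by (intro the_equality) blast+
  then show ?thesis
    by (simp add: comp_index_def)
qed

lemma ex_comp_index:
  assumes p: "p \<in> set_compositions U" and u: "u \<in> U"
  obtains i where "i < length p" "u \<in> p ! i" "comp_index p u = Suc i"
proof -
  obtain X where "X \<in> set p" "u \<in> X"
    using assms by (auto simp: set_compositions_def partition_on_def)
  then obtain i where "i < length p" "u \<in> p ! i"
    by (auto simp: in_set_conv_nth)
  then show ?thesis using comp_index_eq[OF p] that by blast
qed

lemma comp_index_Cons:
  assumes p: "X # p \<in> set_compositions U" and u: "u \<in> U"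
  shows "comp_index (X # p) u = (if u \<in> X then 1 else Suc (comp_index p u))"
proof (cases "u \<in> X")
  case True
  then show ?thesis using comp_index_eq[OF p, of 0 u] by simp
next
  case False
  then have "p \<in> set_compositions (U - X)" "u \<in> U - X"
    using p u by (auto simp: set_compositions_Cons)
  then obtain i where "i < length p" "u \<in> p ! i" "comp_index p u = Suc i"
    by (rule ex_comp_index)
  then show ?thesis using comp_index_eq[OF p, of "Suc i" u] False by simp
qed

section \<open>Restrictions of compositions\<close>

lemma comp_restrict_Nil [simp]: "comp_restrict [] A = []"
  by (simp add: comp_restrict_def)

lemma comp_restrict_Cons:
  "comp_restrict (X # p) A = (if X \<inter> A = {} then comp_restrict p A else (X \<inter> A) # comp_restrict p A)"
  by (simp add: comp_restrict_def)

lemma comp_restrict_append: "comp_restrict (p @ q) A = comp_restrict p A @ comp_restrict q A"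
  by (simp add: comp_restrict_def)

lemma comp_restrict_in_set_compositions:
  "p \<in> set_compositions U \<Longrightarrow> comp_restrict p A \<in> set_compositions (U \<inter> A)"
proof (induction p arbitrary: U)
  case (Cons X p)
  then have X: "X \<noteq> {}" "X \<subseteq> U" and p: "comp_restrict p A \<in> set_compositions ((U - X) \<inter> A)"
    by (auto simp: set_compositions_Cons)
  show ?case
  proof (cases "X \<inter> A = {}")
    case True
    then have "(U - X) \<inter> A = U \<inter> A" by auto
    then show ?thesis using p True by (simp add: comp_restrict_Cons)
  next
    case False
    have "(U - X) \<inter> A = U \<inter> A - X \<inter> A" by auto
    then show ?thesis using p False X by (auto simp: comp_restrict_Cons set_compositions_Cons)
  qed
qed simp

text \<open>Deleting emptied parts changes indices but not their order. A first part that misses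
  \<open>A\<close> raises both indices in \<open>p\<close> by one and leaves both indices in the
  restriction unchanged.\<close>

lemma comp_index_comp_restrict_less_iff:
  "p \<in> set_compositions U \<Longrightarrow> a \<in> U \<inter> A \<Longrightarrow> b \<in> U \<inter> A \<Longrightarrow>
    comp_index (comp_restrict p A) a < comp_index (comp_restrict p A) b \<longleftrightarrow>
    comp_index p a < comp_index p b"
proof (induction p arbitrary: U)
  case (Cons X p)
  have p: "p \<in> set_compositions (U - X)" using Cons.prems(1) by (simp add: set_compositions_Cons)
  have r: "comp_restrict (X # p) A \<in> set_compositions (U \<inter> A)"
    by (rule comp_restrict_in_set_compositions[OF Cons.prems(1)])
  have idx: "comp_index (X # p) u = (if u \<in> X then 1 else Suc (comp_index p u))" if "u \<in> U \<inter> A" for u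
    by (rule comp_index_Cons[OF Cons.prems(1)]) (use that in auto)
  have IH: "comp_index (comp_restrict p A) a < comp_index (comp_restrict p A) b \<longleftrightarrow>
      comp_index p a < comp_index p b" if "a \<notin> X" "b \<notin> X"
    by (rule Cons.IH[OF p]) (use that Cons.prems in auto)
  \<comment> \<open>Indices start at 1, so elements outside \<open>X\<close> have index at least 2
    and come strictly after those in \<open>X\<close>.\<close>
  have pos: "0 < comp_index q u" for q u by (simp add: comp_index_def)
  show ?case
  proof (cases "X \<inter> A = {}")
    case True
    then have "a \<notin> X" "b \<notin> X" using Cons.prems by auto
    then show ?thesis
      using IH idx[of a] idx[of b] Cons.prems True by (simp add: comp_restrict_Cons)
  next
    case False
    have ridx: "comp_index (comp_restrict (X # p) A) u =
        (if u \<in> X then 1 else Suc (comp_index (comp_restrict p A) u))" if "u \<in> U \<inter> A" for u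
      using comp_index_Cons[of "X \<inter> A" "comp_restrict p A" "U \<inter> A" u] r False that
      by (auto simp: comp_restrict_Cons)
    show ?thesis
      using ridx[of a] ridx[of b] idx[of a] idx[of b] IH Cons.prems(2,3)
        pos[of p] pos[of "comp_restrict p A"]
      by (cases "a \<in> X"; cases "b \<in> X") simp_all
  qed
qed simp

lemma comp_restrict_id: "p \<in> set_compositions U \<Longrightarrow> U \<subseteq> A \<Longrightarrow> comp_restrict p A = p"
proof (induction p arbitrary: U)
  case (Cons X p)
  then have "comp_restrict p A = p" "X \<inter> A = X" "X \<noteq> {}"
    by (auto simp: set_compositions_Cons)
  then show ?case by (simp add: comp_restrict_Cons)
qed simp

lemma comp_restrict_empty:
  assumes "p \<in> set_compositions U" "U \<inter> A = {}"
  shows "comp_restrict p A = []"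
proof -
  have "comp_restrict p A \<in> set_compositions {}"
    using comp_restrict_in_set_compositions[OF assms(1), of A] assms(2) by simp
  then show ?thesis by (cases "comp_restrict p A") (auto simp: set_compositions_Cons)
qed

section \<open>Concatenations and the relation \<open>comp_less\<close>\<close>

lemma append_in_set_compositions:
  "t \<in> set_compositions A \<Longrightarrow> s \<in> set_compositions B \<Longrightarrow> A \<inter> B = {} \<Longrightarrow>
    t @ s \<in> set_compositions (A \<union> B)"
proof (induction t arbitrary: A)
  case (Cons X t)
  then have "t @ s \<in> set_compositions ((A - X) \<union> B)"
    by (intro Cons.IH) (auto simp: set_compositions_Cons)
  moreover have "(A - X) \<union> B = (A \<union> B) - X"
    using Cons.prems by (auto simp: set_compositions_Cons)
  ultimately show ?case using Cons.prems by (auto simp: set_compositions_Cons)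
qed simp

lemma comp_less_iff_comp_index:
  assumes p: "p \<in> set_compositions U" and "A \<subseteq> U" "B \<subseteq> U"
  shows "comp_less p A B \<longleftrightarrow> (\<forall>a\<in>A. \<forall>b\<in>B. comp_index p a < comp_index p b)"
proof
  assume l: "comp_less p A B"
  show "\<forall>a\<in>A. \<forall>b\<in>B. comp_index p a < comp_index p b"
  proof (intro ballI)
    fix a b assume ab: "a \<in> A" "b \<in> B"
    obtain i where i: "i < length p" "a \<in> p ! i" "comp_index p a = Suc i"
      by (rule ex_comp_index[OF p, of a]) (use ab assms in auto)
    obtain j where j: "j < length p" "b \<in> p ! j" "comp_index p b = Suc j"
      by (rule ex_comp_index[OF p, of b]) (use ab assms in auto)
    show "comp_index p a < comp_index p b"
      using l ab i j by (simp add: comp_less_def)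
  qed
next
  assume less: "\<forall>a\<in>A. \<forall>b\<in>B. comp_index p a < comp_index p b"
  have "i < j" if "a \<in> A" "b \<in> B" "i < length p" "j < length p" "a \<in> p ! i" "b \<in> p ! j" for a b i j
  proof -
    have "comp_index p a < comp_index p b" using less that(1,2) by blast
    then show ?thesis
      by (simp add: comp_index_eq[OF p that(3,5)] comp_index_eq[OF p that(4,6)])
  qed
  then show "comp_less p A B"
    unfolding comp_less_def by blast
qed

lemma comp_less_append:
  assumes t: "t \<in> set_compositions A" and s: "s \<in> set_compositions B" and disj: "A \<inter> B = {}"
  shows "comp_less (t @ s) A B"
proof -
  have tA: "t ! i \<subseteq> A" if "i < length t" for i
    using t that nth_mem[OF that] by (auto simp: set_compositions_def partition_on_def)
  have sB: "s ! i \<subseteq> B" if "i < length s" for i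
    using s that nth_mem[OF that] by (auto simp: set_compositions_def partition_on_def)
  have 1: "i < length t" if "a \<in> A" "i < length (t @ s)" "a \<in> (t @ s) ! i" for a i
  proof (rule ccontr)
    assume i: "\<not> i < length t"
    then have "i - length t < length s" "a \<in> s ! (i - length t)"
      using that by (simp_all add: nth_append)
    then show False using sB that(1) disj by blast
  qed
  have 2: "length t \<le> j" if "b \<in> B" "j < length (t @ s)" "b \<in> (t @ s) ! j" for b j
  proof (rule ccontr)
    assume "\<not> length t \<le> j"
    then have "j < length t" "b \<in> t ! j"
      using that by (simp_all add: nth_append)
    then show False using tA that(1) disj by blast
  qed
  show ?thesis
    unfolding comp_less_def using 1 2 by (meson less_le_trans)
qed

text \<open>One half of the bijection behind the coproduct. A first part that avoids
  \<open>B\<close> lies in \<open>A\<close> and is peeled off. A first part that meets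
  \<open>B\<close> leaves no place before it for elements of \<open>A\<close>, so \<open>A\<close>
  is not met by any part.\<close>

lemma comp_restrict_append_comp_restrict:
  "p \<in> set_compositions U \<Longrightarrow> U \<subseteq> A \<union> B \<Longrightarrow> A \<inter> B = {} \<Longrightarrow> comp_less p A B \<Longrightarrow>
    comp_restrict p A @ comp_restrict p B = p"
proof (induction p arbitrary: U)
  case (Cons X p)
  have X: "X \<noteq> {}" "X \<subseteq> U" and p: "p \<in> set_compositions (U - X)"
    using Cons.prems(1) by (auto simp: set_compositions_Cons)
  have l: "i < j" if "a \<in> A" "b \<in> B" "i < length (X # p)" "j < length (X # p)"
      "a \<in> (X # p) ! i" "b \<in> (X # p) ! j" for a b i j
    using Cons.prems(4) that unfolding comp_less_def by blast
  have "comp_less p A B"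
    unfolding comp_less_def using l[of _ _ "Suc _" "Suc _"] by simp
  then have IH: "comp_restrict p A @ comp_restrict p B = p"
    using Cons.IH[OF p] Cons.prems by blast
  show ?case
  proof (cases "X \<inter> B = {}")
    case True
    then have "X \<inter> A = X" using X Cons.prems(2) by auto
    then show ?thesis using IH True X by (simp add: comp_restrict_Cons)
  next
    case False
    then obtain b where b: "b \<in> X" "b \<in> B" by auto
    have "U \<inter> A = {}"
    proof (rule ccontr)
      assume "U \<inter> A \<noteq> {}"
      then obtain a where a: "a \<in> U" "a \<in> A" by auto
      obtain i where "i < length (X # p)" "a \<in> (X # p) ! i"
        by (rule ex_comp_index[OF Cons.prems(1) a(1)])
      then show False using l[of a b i 0] a b by simp
    qed
    then have "comp_restrict p A = []" "X \<inter> A = {}" "X \<inter> B = X"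
      using comp_restrict_empty[OF p, of A] X Cons.prems(2) by auto
    then show ?thesis using IH X by (simp add: comp_restrict_Cons)
  qed
qed simp

section \<open>Relabelled compositions\<close>

lemma map_image_in_set_compositions:
  "p \<in> set_compositions U \<Longrightarrow> inj_on \<sigma> U \<Longrightarrow> map ((`) \<sigma>) p \<in> set_compositions (\<sigma> ` U)"
proof (induction p arbitrary: U)
  case (Cons X p)
  then have X: "X \<noteq> {}" "X \<subseteq> U" and p: "p \<in> set_compositions (U - X)"
    by (auto simp: set_compositions_Cons)
  have "map ((`) \<sigma>) p \<in> set_compositions (\<sigma> ` (U - X))"
    by (rule Cons.IH[OF p inj_on_subset[OF Cons.prems(2)]]) auto
  moreover have "\<sigma> ` (U - X) = \<sigma> ` U - \<sigma> ` X"
    using inj_on_image_set_diff[OF Cons.prems(2), of U X] X(2) by auto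
  ultimately show ?case using X by (auto simp: set_compositions_Cons)
qed simp

lemma comp_index_map_image:
  assumes p: "p \<in> set_compositions U" and inj: "inj_on \<sigma> U" and u: "u \<in> U"
  shows "comp_index (map ((`) \<sigma>) p) (\<sigma> u) = comp_index p u"
proof -
  obtain i where i: "i < length p" "u \<in> p ! i" "comp_index p u = Suc i"
    by (rule ex_comp_index[OF p u])
  then show ?thesis
    using comp_index_eq[OF map_image_in_set_compositions[OF p inj], of i "\<sigma> u"] by simp
qed

lemma map_image_inv_into:
  assumes "p \<in> set_compositions U" "inj_on \<sigma> U"
  shows "map ((`) (inv_into U \<sigma>)) (map ((`) \<sigma>) p) = p"
proof -
  have "X \<subseteq> U" if "X \<in> set p" for X
    using assms(1) that by (auto simp: set_compositions_def partition_on_def)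
  then show ?thesis
    using assms(2) by (auto simp: inv_into_image_cancel intro!: map_idI)
qed


section \<open>Genericity and the structure maps\<close>

text \<open>Relabelling keeps the number of every part, so weights of bases are preserved exactly
  and the unique minimizer is transported directly, without greedy bases.\<close>

lemma generic_matroid_image:
  assumes M: "matroid M" and inj: "inj_on \<sigma> (ground M)" and p: "p \<in> set_compositions (ground M)"
  shows "generic (matroid_image \<sigma> M) (map ((`) \<sigma>) p) \<longleftrightarrow> generic M p"
proof -
  have sub: "B \<subseteq> ground M" if "B \<in> bases M" for B
    using that indep_finite(2)[OF M] by (auto simp: bases_def)
  have "inj_on ((`) \<sigma>) (bases M)"
    by (rule inj_onI) (use sub in \<open>simp add: inj_on_image_eq_iff[OF inj]\<close>)
  moreover have "(\<Sum>u\<in>\<sigma> ` B. comp_index (map ((`) \<sigma>) p) u) = (\<Sum>u\<in>B. comp_index p u)"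
    if "B \<in> bases M" for B
    using sub[OF that]
    by (subst sum.reindex[OF inj_on_subset[OF inj sub[OF that]]])
      (auto intro!: sum.cong comp_index_map_image[OF p inj])
  ultimately show ?thesis
    unfolding generic_def bases_matroid_image[OF M inj] by (rule ex1_is_arg_min_reindex)
qed

lemma greedy_basis_subset_ground:
  assumes "matroid M" "greedy_basis M w B"
  shows "B \<subseteq> ground M"
  using assms indep_finite(2)[OF assms(1), of B] by (auto simp: greedy_basis_def bases_def)

lemma generic_direct_sum:
  assumes M: "matroid M" and N: "matroid N" and disj: "ground M \<inter> ground N = {}"
    and p: "p \<in> set_compositions (ground M \<union> ground N)"
  shows "generic (direct_sum M N) p \<longleftrightarrow>
    generic M (comp_restrict p (ground M)) \<and> generic N (comp_restrict p (ground N))"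
proof -
  let ?w = "comp_index p"
  \<comment> \<open>The two weights may differ in value, but they order \<open>ground M\<close>
    alike.\<close>
  have cM: "greedy_basis M ?w B \<longleftrightarrow> greedy_basis M (comp_index (comp_restrict p (ground M))) B" for B
    by (rule greedy_basis_cong_order[OF M], rule comp_index_comp_restrict_less_iff[OF p, symmetric])
      auto
  have cN: "greedy_basis N ?w B \<longleftrightarrow> greedy_basis N (comp_index (comp_restrict p (ground N))) B" for B
    by (rule greedy_basis_cong_order[OF N], rule comp_index_comp_restrict_less_iff[OF p, symmetric])
      auto
  have "(\<exists>B. greedy_basis (direct_sum M N) ?w B) \<longleftrightarrow>
      (\<exists>B. greedy_basis M ?w B) \<and> (\<exists>B. greedy_basis N ?w B)"
  proof
    assume "\<exists>B. greedy_basis (direct_sum M N) ?w B"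
    then obtain B where B: "greedy_basis (direct_sum M N) ?w B" ..
    then show "(\<exists>B. greedy_basis M ?w B) \<and> (\<exists>B. greedy_basis N ?w B)"
      using greedy_basis_direct_sum[OF M N disj, of B ?w]
        greedy_basis_subset_ground[OF matroid_direct_sum[OF M N disj] B] by auto
  next
    assume "(\<exists>B. greedy_basis M ?w B) \<and> (\<exists>B. greedy_basis N ?w B)"
    then obtain B C where B: "greedy_basis M ?w B" and C: "greedy_basis N ?w C" by blast
    have sub: "B \<subseteq> ground M" "C \<subseteq> ground N"
      using greedy_basis_subset_ground M N B C by blast+
    then have e: "(B \<union> C) \<inter> ground M = B" "(B \<union> C) \<inter> ground N = C"
      using disj by auto
    have "greedy_basis (direct_sum M N) ?w (B \<union> C)"
      using greedy_basis_direct_sum[OF M N disj, of "B \<union> C" ?w] sub B C unfolding e by auto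
    then show "\<exists>B. greedy_basis (direct_sum M N) ?w B" ..
  qed
  then show ?thesis
    using cM cN by (simp add: generic_iff_greedy_basis M N matroid_direct_sum disj)
qed

lemma generic_restriction_contraction:
  assumes M: "matroid M" and ground: "ground M = A \<union> B" and disj: "A \<inter> B = {}"
    and p: "p \<in> set_compositions (A \<union> B)" and less: "comp_less p A B"
  shows "generic M p \<longleftrightarrow>
    generic (restriction M A) (comp_restrict p A) \<and> generic (contraction M A) (comp_restrict p B)"
proof -
  let ?w = "comp_index p" and ?R = "restriction M A" and ?C = "contraction M A"
  have A: "A \<subseteq> ground M" and B: "ground M - A = B"
    using ground disj by auto
  note R = matroid_restriction[OF M A] and C = matroid_contraction[OF M A]
  \<comment> \<open>This is where the order of the parts enters: everything in \<open>A\<close> is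
    lighter than everything in \<open>B\<close>, as the splitting into restriction and contraction
    requires.\<close>
  have w: "?w a < ?w b" if "a \<in> A" "b \<in> ground M - A" for a b
    using less that unfolding B by (simp add: comp_less_iff_comp_index[OF p])
  have cR: "greedy_basis ?R ?w X \<longleftrightarrow> greedy_basis ?R (comp_index (comp_restrict p A)) X" for X
    by (rule greedy_basis_cong_order[OF R], rule comp_index_comp_restrict_less_iff[OF p, symmetric])
      auto
  have cC: "greedy_basis ?C ?w X \<longleftrightarrow> greedy_basis ?C (comp_index (comp_restrict p B)) X" for X
    by (rule greedy_basis_cong_order[OF C], rule comp_index_comp_restrict_less_iff[OF p, symmetric])
      (auto simp: ground)
  have split: "greedy_basis M ?w X \<longleftrightarrow> greedy_basis ?R ?w (X \<inter> A) \<and> greedy_basis ?C ?w (X - A)"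
    if "X \<subseteq> ground M" for X
    by (rule greedy_basis_restriction_contraction[OF M A that]) (rule w)
  have "(\<exists>X. greedy_basis M ?w X) \<longleftrightarrow> (\<exists>X. greedy_basis ?R ?w X) \<and> (\<exists>X. greedy_basis ?C ?w X)"
  proof
    assume "\<exists>X. greedy_basis M ?w X"
    then obtain X where X: "greedy_basis M ?w X" ..
    then show "(\<exists>X. greedy_basis ?R ?w X) \<and> (\<exists>X. greedy_basis ?C ?w X)"
      using split[OF greedy_basis_subset_ground[OF M X]] by blast
  next
    assume "(\<exists>X. greedy_basis ?R ?w X) \<and> (\<exists>X. greedy_basis ?C ?w X)"
    then obtain X Y where X: "greedy_basis ?R ?w X" and Y: "greedy_basis ?C ?w Y" by blast
    have sub: "X \<subseteq> A" "Y \<subseteq> ground M - A"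
      using greedy_basis_subset_ground[OF R X] greedy_basis_subset_ground[OF C Y] by simp_all
    then have e: "(X \<union> Y) \<inter> A = X" "(X \<union> Y) - A = Y" and XY: "X \<union> Y \<subseteq> ground M"
      using A by auto
    have "greedy_basis M ?w (X \<union> Y)"
      using split[OF XY] X Y unfolding e by blast
    then show "\<exists>X. greedy_basis M ?w X" ..
  qed
  then show ?thesis
    using cR cC by (simp add: generic_iff_greedy_basis M R C)
qed


section \<open>The morphism\<close>

lemma Mat_simps [simp]:
  "hm_basis Mat = matroids_on"
  "hm_relabel Mat = Mat_relabel"
  "hm_unit Mat = basis_vec (Indep_System {} {{}})"
  "hm_counit Mat x = Poly_Mapping.lookup x (Indep_System {} {{}})"
  "hm_mult Mat A B (basis_vec (M, N)) = basis_vec (direct_sum M N)"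
  "hm_comult Mat A B (basis_vec M) = basis_vec (restriction M A, contraction M A)"
  "Mat_relabel \<sigma> (basis_vec M) = basis_vec (matroid_image \<sigma> M)"
  by (simp_all add: Mat_def Mat_relabel_def)

lemma WQSym_simps [simp]:
  "hm_basis WQSym = set_compositions"
  "hm_relabel WQSym = WQSym_relabel"
  "hm_unit WQSym = basis_vec []"
  "hm_counit WQSym x = Poly_Mapping.lookup x []"
  "hm_mult WQSym A B (basis_vec (t, s)) =
    (\<Sum>p | p \<in> set_compositions (A \<union> B) \<and> comp_restrict p A = t \<and> comp_restrict p B = s.
      basis_vec p)"
  "hm_comult WQSym A B (basis_vec p) =
    (if comp_less p A B then basis_vec (comp_restrict p A, comp_restrict p B) else 0)"
  "WQSym_relabel \<sigma> (basis_vec p) = basis_vec (map ((`) \<sigma>) p)"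
  by (simp_all add: WQSym_def WQSym_relabel_def)

lemma linear_Mat_relabel: "linear (Mat_relabel \<sigma>)"
  unfolding Mat_relabel_def by (rule linear_lin_ext)

lemma linear_WQSym_relabel: "linear (WQSym_relabel \<sigma>)"
  unfolding WQSym_relabel_def by (rule linear_lin_ext)

lemma linear_Mat_mult: "linear (hm_mult Mat A B)"
  by (simp add: Mat_def linear_lin_ext)

lemma linear_Mat_comult: "linear (hm_comult Mat A B)"
  by (simp add: Mat_def linear_lin_ext)

lemma linear_WQSym_mult: "linear (hm_mult WQSym A B)"
  by (simp add: WQSym_def linear_lin_ext)

lemma linear_WQSym_comult: "linear (hm_comult WQSym A B)"
  by (simp add: WQSym_def linear_lin_ext)

lemma linear_lookup: "linear (\<lambda>x :: 'b \<Rightarrow>\<^sub>0 real. Poly_Mapping.lookup x b)"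
  by (rule linearI) (simp_all add: lookup_add)

lemma linear_hopf_monoid_data_Mat: "linear_hopf_monoid_data Mat"
proof (rule linear_hopf_monoid_data.intro)
  show "linear (hm_relabel Mat \<sigma>)" for \<sigma> :: "nat \<Rightarrow> nat"
    unfolding Mat_simps by (rule linear_Mat_relabel)
  show "linear (hm_counit (Mat :: (nat, _) hopf_monoid_data))"
    unfolding Mat_def by (simp add: linear_lookup)
qed (rule linear_Mat_mult linear_Mat_comult)+

lemma linear_hopf_monoid_data_WQSym: "linear_hopf_monoid_data WQSym"
proof (rule linear_hopf_monoid_data.intro)
  show "linear (hm_relabel WQSym \<sigma>)" for \<sigma> :: "nat \<Rightarrow> nat"
    unfolding WQSym_simps by (rule linear_WQSym_relabel)
  show "linear (hm_counit (WQSym :: (nat, _) hopf_monoid_data))"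
    unfolding WQSym_def by (simp add: linear_lookup)
qed (rule linear_WQSym_mult linear_WQSym_comult)+

lemma linear_Psi: "linear (Psi U)"
  unfolding Psi_def by (rule linear_lin_ext)

text \<open>The ground set is read off from \<open>M\<close>, so the sums for \<open>U\<close>,
  \<open>A\<close> and \<open>B\<close> have index sets of the same form.\<close>

definition generic_compositions :: "'a indep_system \<Rightarrow> 'a set list set"
  where "generic_compositions M = {p \<in> set_compositions (ground M). generic M p}"

lemma Psi_basis_vec:
  "M \<in> matroids_on U \<Longrightarrow> Psi U (basis_vec M) = (\<Sum>p\<in>generic_compositions M. basis_vec p)"
  by (auto simp: Psi_def generic_compositions_def matroids_on_def)

text \<open>Two element types are allowed because \<open>hm_relabel\<close> in the record ties
  \<open>hopf_monoid_morphism\<close> to bijections within one type.\<close>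

lemma Psi_natural:
  fixes U :: "'a set" and V :: "'b set"
  assumes \<sigma>: "bij_betw \<sigma> U V" and x: "x \<in> free_space (matroids_on U)"
  shows "Psi V (Mat_relabel \<sigma> x) = WQSym_relabel \<sigma> (Psi U x)"
proof (rule linear_eq_on_free_space[OF _ _ x])
  show "linear (\<lambda>x. Psi V (Mat_relabel \<sigma> x))" "linear (\<lambda>x. WQSym_relabel \<sigma> (Psi U x))"
    by (rule linear_comp[OF linear_Psi linear_Mat_relabel]
        linear_comp[OF linear_WQSym_relabel linear_Psi])+
next
  fix M :: "'a indep_system" assume MU: "M \<in> matroids_on U"
  then have M: "matroid M" and U: "ground M = U" by (auto simp: matroids_on_def)
  have inj: "inj_on \<sigma> U" and V: "V = \<sigma> ` U"
    using \<sigma> by (auto simp: bij_betw_def)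
  let ?N = "matroid_image \<sigma> M" and ?\<tau> = "inv_into U \<sigma>"
  have gN: "ground ?N = V" by (simp add: matroid_image_def U V)
  have NV: "?N \<in> matroids_on V"
    using matroid_image[OF M] inj gN by (simp add: matroids_on_def U)
  have inj': "inj_on ?\<tau> V" and U': "?\<tau> ` V = U"
    using bij_betw_inv_into[OF \<sigma>] by (auto simp: bij_betw_def)
  have gen: "generic ?N (map ((`) \<sigma>) p) \<longleftrightarrow> generic M p" if "p \<in> set_compositions U" for p
    by (rule generic_matroid_image) (use M inj that in \<open>simp_all add: U\<close>)
  have inv: "map ((`) ?\<tau>) q \<in> set_compositions U" "map ((`) \<sigma>) (map ((`) ?\<tau>) q) = q"
    if q: "q \<in> set_compositions V" for q
  proof -
    show *: "map ((`) ?\<tau>) q \<in> set_compositions U"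
      using map_image_in_set_compositions[OF q inj'] by (simp only: U')
    have "\<sigma> ` ?\<tau> ` X = X" if "X \<in> set q" for X
      by (rule image_inv_into_cancel[OF V[symmetric]])
        (use set_compositionsD(1)[OF q] that in auto)
    then show "map ((`) \<sigma>) (map ((`) ?\<tau>) q) = q"
      unfolding map_map comp_def by (intro map_idI)
  qed
  have "Psi V (Mat_relabel \<sigma> (basis_vec M)) = (\<Sum>q\<in>generic_compositions ?N. basis_vec q)"
    by (simp add: Psi_basis_vec[OF NV])
  also have "\<dots> = (\<Sum>p\<in>generic_compositions M. basis_vec (map ((`) \<sigma>) p))"
  proof (rule sum.reindex_bij_witness[where i = "map ((`) \<sigma>)" and j = "map ((`) ?\<tau>)"])
    fix q assume "q \<in> generic_compositions ?N"
    then have q: "q \<in> set_compositions V" "generic ?N q"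
      by (simp_all add: generic_compositions_def gN)
    show "map ((`) \<sigma>) (map ((`) ?\<tau>) q) = q" by (rule inv(2)[OF q(1)])
    show "map ((`) ?\<tau>) q \<in> generic_compositions M"
      using gen[OF inv(1)[OF q(1)]] inv[OF q(1)] q(2)
      unfolding generic_compositions_def U by simp
    show "basis_vec (map ((`) \<sigma>) (map ((`) ?\<tau>) q)) = basis_vec q"
      by (simp only: inv(2)[OF q(1)])
  next
    fix p assume "p \<in> generic_compositions M"
    then have p: "p \<in> set_compositions U" "generic M p"
      by (simp_all add: generic_compositions_def U)
    show "map ((`) ?\<tau>) (map ((`) \<sigma>) p) = p" by (rule map_image_inv_into[OF p(1) inj])
    show "map ((`) \<sigma>) p \<in> generic_compositions ?N"
      using gen[OF p(1)] p(2) map_image_in_set_compositions[OF p(1) inj]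
      unfolding generic_compositions_def gN V by simp
  qed
  also have "\<dots> = WQSym_relabel \<sigma> (Psi U (basis_vec M))"
    by (simp add: Psi_basis_vec[OF MU] linear_sum[OF linear_WQSym_relabel])
  finally show "Psi V (Mat_relabel \<sigma> (basis_vec M)) = WQSym_relabel \<sigma> (Psi U (basis_vec M))" .
qed

section \<open>Products\<close>

lemma finite_generic_compositions: "matroid M \<Longrightarrow> finite (generic_compositions M)"
  by (simp add: generic_compositions_def finite_set_compositions matroidD(1))

text \<open>Each composition of \<open>A \<union> B\<close> has one pair of restrictions, and the
  pair alone decides its genericity. Grouping the generic compositions by their pairs therefore
  gives full fibres, and the sum over a fibre is a product in \<open>WQSym\<close>.\<close>

lemma Psi_mult:
  assumes disj: "A \<inter> B = {}" and z: "z \<in> free_space (matroids_on A \<times> matroids_on B)"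
  shows "Psi (A \<union> B) (hm_mult Mat A B z) = hm_mult WQSym A B (tensor_map (Psi A) (Psi B) z)"
proof (rule linear_eq_on_free_space[OF _ _ z])
  show "linear (\<lambda>z. Psi (A \<union> B) (hm_mult Mat A B z))"
    "linear (\<lambda>z. hm_mult WQSym A B (tensor_map (Psi A) (Psi B) z))"
    by (rule linear_comp[OF linear_Psi linear_Mat_mult]
        linear_comp[OF linear_WQSym_mult linear_tensor_map])+
next
  fix MN :: "'a indep_system \<times> 'a indep_system"
  assume "MN \<in> matroids_on A \<times> matroids_on B"
  then obtain M N where MN: "MN = (M, N)" and MA: "M \<in> matroids_on A" and NB: "N \<in> matroids_on B"
    by auto
  then have M: "matroid M" "ground M = A" and N: "matroid N" "ground N = B"
    by (auto simp: matroids_on_def)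
  have S: "direct_sum M N \<in> matroids_on (A \<union> B)"
    using matroid_direct_sum[OF M(1) N(1)] disj by (simp add: matroids_on_def M N)
  let ?T = "generic_compositions M" and ?S = "generic_compositions N"
  let ?G = "generic_compositions (direct_sum M N)"
  let ?r = "\<lambda>p. (comp_restrict p A, comp_restrict p B)"
  have gen: "generic (direct_sum M N) p \<longleftrightarrow>
      generic M (comp_restrict p A) \<and> generic N (comp_restrict p B)"
    if "p \<in> set_compositions (A \<union> B)" for p
    using generic_direct_sum[OF M(1) N(1)] disj that by (simp add: M N)
  have r: "comp_restrict p A \<in> set_compositions A" "comp_restrict p B \<in> set_compositions B"
    if "p \<in> set_compositions (A \<union> B)" for p
    using comp_restrict_in_set_compositions[OF that, of A]
      comp_restrict_in_set_compositions[OF that, of B] by (simp_all add: Int_absorb1)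
  have img: "?r ` ?G \<subseteq> ?T \<times> ?S"
    using gen r by (auto simp: generic_compositions_def M N)
  have fib: "{p \<in> ?G. ?r p = ts} =
      {p. p \<in> set_compositions (A \<union> B) \<and> comp_restrict p A = fst ts \<and> comp_restrict p B = snd ts}"
    if "ts \<in> ?T \<times> ?S" for ts
    using that gen by (auto simp: generic_compositions_def M N)
  have fin: "finite ?T" "finite ?S" "finite ?G"
    using finite_generic_compositions M(1) N(1) S by (auto simp: matroids_on_def)
  have "Psi (A \<union> B) (hm_mult Mat A B (basis_vec MN)) = (\<Sum>p\<in>?G. basis_vec p)"
    by (simp add: MN Psi_basis_vec[OF S])
  also have "\<dots> = (\<Sum>ts\<in>?T \<times> ?S. \<Sum>p\<in>{p \<in> ?G. ?r p = ts}. basis_vec p)"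
    by (rule sum.group[symmetric]) (use fin img in auto)
  also have "\<dots> = (\<Sum>ts\<in>?T \<times> ?S. hm_mult WQSym A B (basis_vec ts))"
  proof (rule sum.cong[OF refl])
    fix ts assume ts: "ts \<in> ?T \<times> ?S"
    show "(\<Sum>p\<in>{p \<in> ?G. ?r p = ts}. basis_vec p) = hm_mult WQSym A B (basis_vec ts)"
      unfolding fib[OF ts] by (cases ts) simp
  qed
  also have "\<dots> = hm_mult WQSym A B (tensor (Psi A (basis_vec M)) (Psi B (basis_vec N)))"
    by (simp add: Psi_basis_vec[OF MA] Psi_basis_vec[OF NB] tensor_sum
        linear_sum[OF linear_WQSym_mult] case_prod_beta)
  finally show "Psi (A \<union> B) (hm_mult Mat A B (basis_vec MN)) =
      hm_mult WQSym A B (tensor_map (Psi A) (Psi B) (basis_vec MN))"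
    by (simp add: MN)
qed

section \<open>Coproducts\<close>

lemma restriction_contraction_in_matroids_on:
  assumes "M \<in> matroids_on (A \<union> B)" "A \<inter> B = {}"
  shows "restriction M A \<in> matroids_on A" "contraction M A \<in> matroids_on B"
  using assms matroid_restriction[of M A] matroid_contraction[of M A]
  by (auto simp: matroids_on_def)

text \<open>After the vanishing terms are dropped, restricting to \<open>A\<close> and
  \<open>B\<close> is a bijection from the remaining generic compositions to pairs of generic ones,
  with concatenation as inverse. All coefficients are therefore 1 on both sides.\<close>

lemma Psi_comult:
  assumes disj: "A \<inter> B = {}" and x: "x \<in> free_space (matroids_on (A \<union> B))"
  shows "hm_comult WQSym A B (Psi (A \<union> B) x) = tensor_map (Psi A) (Psi B) (hm_comult Mat A B x)"
proof (rule linear_eq_on_free_space[OF _ _ x])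
  show "linear (\<lambda>x. hm_comult WQSym A B (Psi (A \<union> B) x))"
    "linear (\<lambda>x. tensor_map (Psi A) (Psi B) (hm_comult Mat A B x))"
    by (rule linear_comp[OF linear_WQSym_comult linear_Psi]
        linear_comp[OF linear_tensor_map linear_Mat_comult])+
next
  fix M :: "'a indep_system" assume MAB: "M \<in> matroids_on (A \<union> B)"
  then have M: "matroid M" "ground M = A \<union> B" by (auto simp: matroids_on_def)
  let ?R = "restriction M A" and ?C = "contraction M A"
  have R: "?R \<in> matroids_on A" and C: "?C \<in> matroids_on B"
    using restriction_contraction_in_matroids_on[OF MAB disj] .
  have gR: "ground ?R = A" and gC: "ground ?C = B"
    using R C by (auto simp: matroids_on_def)
  let ?G = "generic_compositions M" and ?T = "generic_compositions ?R" and ?S = "generic_compositions ?C"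
  have gen: "generic M p \<longleftrightarrow> generic ?R (comp_restrict p A) \<and> generic ?C (comp_restrict p B)"
    if "p \<in> set_compositions (A \<union> B)" "comp_less p A B" for p
    by (rule generic_restriction_contraction[OF M disj that])
  have "hm_comult WQSym A B (Psi (A \<union> B) (basis_vec M)) =
      (\<Sum>p\<in>?G. if comp_less p A B then basis_vec (comp_restrict p A, comp_restrict p B) else 0)"
    by (simp add: Psi_basis_vec[OF MAB] linear_sum[OF linear_WQSym_comult])
  also have "\<dots> = (\<Sum>p\<in>{p \<in> ?G. comp_less p A B}. basis_vec (comp_restrict p A, comp_restrict p B))"
    by (rule sum.inter_filter[symmetric]) (rule finite_generic_compositions[OF M(1)])
  also have "\<dots> = (\<Sum>(t, s)\<in>?T \<times> ?S. basis_vec (t, s))"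
  proof (rule sum.reindex_bij_witness[where i = "\<lambda>(t, s). t @ s"
        and j = "\<lambda>p. (comp_restrict p A, comp_restrict p B)"])
    fix p assume "p \<in> {p \<in> ?G. comp_less p A B}"
    then have p: "p \<in> set_compositions (A \<union> B)" "generic M p" "comp_less p A B"
      by (auto simp: generic_compositions_def M)
    show "(case (comp_restrict p A, comp_restrict p B) of (t, s) \<Rightarrow> t @ s) = p"
      using comp_restrict_append_comp_restrict[OF p(1) order_refl disj p(3)] by simp
    show "(comp_restrict p A, comp_restrict p B) \<in> ?T \<times> ?S"
      using gen[OF p(1,3)] p(2) comp_restrict_in_set_compositions[OF p(1), of A]
        comp_restrict_in_set_compositions[OF p(1), of B]
      by (simp add: generic_compositions_def gR gC Int_absorb1 del: ground_simps)
  next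
    fix ts assume "ts \<in> ?T \<times> ?S"
    then obtain t s where ts: "ts = (t, s)"
      and t: "t \<in> set_compositions A" "generic ?R t" and s: "s \<in> set_compositions B" "generic ?C s"
      by (auto simp: generic_compositions_def gR gC simp del: ground_simps)
    have "comp_restrict t A = t" "comp_restrict s A = []" "comp_restrict t B = []"
        "comp_restrict s B = s"
      using comp_restrict_id[OF t(1)] comp_restrict_id[OF s(1)] comp_restrict_empty[OF t(1) disj]
        comp_restrict_empty[OF s(1), of A] disj by (simp_all add: Int_commute)
    then have r: "comp_restrict (t @ s) A = t" "comp_restrict (t @ s) B = s"
      by (simp_all add: comp_restrict_append)
    note ap = append_in_set_compositions[OF t(1) s(1) disj] comp_less_append[OF t(1) s(1) disj]
    show "(comp_restrict (case ts of (t, s) \<Rightarrow> t @ s) A, comp_restrict (case ts of (t, s) \<Rightarrow> t @ s) B) = ts"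
      by (simp add: ts r)
    show "(case ts of (t, s) \<Rightarrow> t @ s) \<in> {p \<in> ?G. comp_less p A B}"
      using gen[OF ap] t(2) s(2) ap by (simp add: ts r generic_compositions_def M)
  qed simp
  also have "\<dots> = tensor (Psi A (basis_vec ?R)) (Psi B (basis_vec ?C))"
    by (simp add: Psi_basis_vec[OF R] Psi_basis_vec[OF C] tensor_sum)
  finally show "hm_comult WQSym A B (Psi (A \<union> B) (basis_vec M)) =
      tensor_map (Psi A) (Psi B) (hm_comult Mat A B (basis_vec M))"
    by simp
qed

section \<open>Units, counits and the conclusion\<close>

lemma matroids_on_empty: "matroids_on {} = {Indep_System {} {{}}}"
proof -
  have "M = Indep_System {} {{}}" if "M \<in> matroids_on {}" for M :: "'a indep_system"
  proof -
    have "ground M = {}" "indep M = {{}}"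
      using that matroidD(2,3)[of M] by (auto simp: matroids_on_def)
    then show ?thesis by (cases M) simp
  qed
  moreover have "Indep_System {} {{}} \<in> matroids_on {}"
    by (auto simp: matroids_on_def matroid_def)
  ultimately show ?thesis by blast
qed

lemma Psi_unit: "Psi {} (basis_vec (Indep_System {} {{}})) = basis_vec []"
proof -
  let ?E = "Indep_System {} {{}} :: 'a indep_system"
  have E: "?E \<in> matroids_on {}" by (simp add: matroids_on_empty)
  have "bases ?E = {{}}" by (auto simp: bases_def)
  then have "generic ?E []" by (auto simp: generic_def is_arg_min_def)
  moreover have "p = []" if "p \<in> set_compositions {}" for p :: "'a set list"
    using that by (cases p) (auto simp: set_compositions_Cons)
  ultimately have "generic_compositions ?E = {[]}"
    by (auto simp: generic_compositions_def)
  then show ?thesis by (simp add: Psi_basis_vec[OF E])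
qed

lemma hopf_monoid_morphism_Psi: "hopf_monoid_morphism Mat WQSym Psi"
  unfolding hopf_monoid_morphism_def
proof (intro conjI allI impI ballI)
  fix U :: "'a set"
  show "linear_between (hm_space Mat U) (hm_space WQSym U) (Psi U)"
    by (rule linear_betweenI[OF linear_Psi])
      (auto simp: Psi_basis_vec generic_compositions_def matroids_on_def intro: sum_in_free_space)
next
  fix x :: "'a indep_system \<Rightarrow>\<^sub>0 real" assume x: "x \<in> hm_space Mat {}"
  show "hm_counit WQSym (Psi {} x) = hm_counit Mat x"
    \<comment> \<open>The space on the empty set is spanned by one vector, so the counit law reduces
      to the unit law.\<close>
    by (rule linear_eq_on_free_space[OF _ _ x])
      (auto simp: matroids_on_empty Psi_unit intro: linear_comp[OF linear_lookup linear_Psi] linear_lookup)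
next
  fix U V :: "'a set" and \<sigma> x
  assume "finite U \<and> bij_betw \<sigma> U V" "x \<in> hm_space Mat U"
  then show "Psi V (hm_relabel Mat \<sigma> x) = hm_relabel WQSym \<sigma> (Psi U x)"
    using Psi_natural[of \<sigma> U V x] by simp
next
  fix A B :: "'a set" and z
  assume "finite A \<and> finite B \<and> A \<inter> B = {}" "z \<in> free_space (hm_basis Mat A \<times> hm_basis Mat B)"
  then show "Psi (A \<union> B) (hm_mult Mat A B z) = hm_mult WQSym A B (tensor_map (Psi A) (Psi B) z)"
    using Psi_mult[of A B z] by simp
next
  fix A B :: "'a set" and x
  assume "finite A \<and> finite B \<and> A \<inter> B = {}" "x \<in> hm_space Mat (A \<union> B)"
  then show "hm_comult WQSym A B (Psi (A \<union> B) x) = tensor_map (Psi A) (Psi B) (hm_comult Mat A B x)"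
    using Psi_comult[of A B x] by simp
qed (simp add: Psi_unit)

theorem theoremB1:
  "hopf_monoid_morphism Mat WQSym (Psi :: 'a set \<Rightarrow> _) \<and>
   (\<forall>(U :: 'a set) (V :: 'b set) \<sigma>. finite U \<and> bij_betw \<sigma> U V \<longrightarrow>
      (\<forall>x\<in>free_space (matroids_on U).
        Psi V (Mat_relabel \<sigma> x) = WQSym_relabel \<sigma> (Psi U x))) \<and>
   hopf_algebra_morphism (hopf_algebra_of Mat) (hopf_algebra_of WQSym) (hopf_algebra_map Psi)"
proof (intro conjI)
  show "hopf_monoid_morphism Mat WQSym (Psi :: 'a set \<Rightarrow> _)"
    by (rule hopf_monoid_morphism_Psi)
  show "\<forall>(U :: 'a set) (V :: 'b set) \<sigma>. finite U \<and> bij_betw \<sigma> U V \<longrightarrow>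
      (\<forall>x\<in>free_space (matroids_on U).
        Psi V (Mat_relabel \<sigma> x) = WQSym_relabel \<sigma> (Psi U x))"
    by (intro allI impI ballI) (elim conjE, rule Psi_natural)
  show "hopf_algebra_morphism (hopf_algebra_of Mat) (hopf_algebra_of WQSym) (hopf_algebra_map Psi)"
  proof (rule hopf_algebra_morphism_hopf_algebra_map[OF linear_hopf_monoid_data_Mat
        linear_hopf_monoid_data_WQSym hopf_monoid_morphism_Psi linear_Psi])
    \<comment> \<open>It remains to see that relabelling and the coproduct of \<open>Mat\<close>
      stay inside the spaces of \<open>Mat\<close>.\<close>
    fix \<sigma> :: "nat \<Rightarrow> nat" and U V M
    assume "bij_betw \<sigma> U V" "M \<in> hm_basis Mat U"
    then have "matroid M" "ground M = U" "inj_on \<sigma> U" "V = \<sigma> ` U"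
      by (auto simp: matroids_on_def bij_betw_def)
    moreover from this have "ground (matroid_image \<sigma> M) = V"
      by (simp add: matroid_image_def)
    ultimately show "hm_relabel Mat \<sigma> (basis_vec M) \<in> hm_space Mat V"
      using matroid_image[of M \<sigma>] by (simp add: matroids_on_def)
  next
    fix A B :: "nat set" and M
    assume "A \<inter> B = {}" "M \<in> hm_basis Mat (A \<union> B)"
    then show "hm_comult Mat A B (basis_vec M) \<in> free_space (hm_basis Mat A \<times> hm_basis Mat B)"
      using restriction_contraction_in_matroids_on[of M A B] by simp
  qed
qed

end
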